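(* Let $p$ be a prime, $G$ a finite group, $S\in\mathrm{Syl}_p(G)$ and $Q\leq S$. Then $Q$ is large in $\mathcal{F}_S(G)$ if and only if the following two conditions hold: (1) $C_S(Q)\leq Q$; (2) for every non-trivial subgroup $P$ of $Z(Q)$, every characteristic subgroup of $Q$ is strongly closed in $N_G(P)$.
   Context: $\mathcal{F}_S(G)$ is the fusion system over $S$ whose morphisms are the maps between subgroups of $S$ induced by conjugation with elements of $G$. For a fusion system $\mathcal{F}$ over a finite $p$-group $S$ and $P\leq S$, $N_{\mathcal{F}}(P)$ is the fusion system over $N_S(P)$ whose morphisms are the $\mathcal{F}$-morphisms $\phi\colon X\to Y$ ($X,Y\leq N_S(P)$) that extend to some $\hat\phi\in\mathrm{Hom}_{\mathcal{F}}(XP,YP)$ with $P\hat\phi=P$. A subgroup $Q\leq S$ is large in $\mathcal{F}$ if $C_S(Q)\leq Q$ and $N_{\mathcal{F}}(U)\subseteq N_{\mathcal{F}}(Q)$ for all $1\neq U\leq Z(Q)$. A $p$-subgroup $X$ of a finite group $H$ is strongly closed in $H$ if, for some (equivalently, every) Sylow $p$-subgroup $T$ of $H$ containing $X$, one has: whenever $x\in X$, $h\in H$ and $x^h\in T$, then $x^h\in X$. *)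

theory Defs
  imports "HOL-Algebra.Bij" "HOL-Algebra.Sylow" "HOL-Algebra.Zassenhaus"
begin

definition centralizer :: "('a, 'b) monoid_scheme \<Rightarrow> 'a set \<Rightarrow> 'a set" where
  "centralizer G A = {g \<in> carrier G. \<forall>a\<in>A. g \<otimes>\<^bsub>G\<^esub> a = a \<otimes>\<^bsub>G\<^esub> g}"

definition center :: "('a, 'b) monoid_scheme \<Rightarrow> 'a set" where
  "center G = centralizer G (carrier G)"

definition characteristic_subgroup :: "'a set \<Rightarrow> ('a, 'b) monoid_scheme \<Rightarrow> bool" where
  "characteristic_subgroup X G \<longleftrightarrow> subgroup X G \<and> (\<forall>f\<in>auto G. f ` X = X)"

definition sylow_subgroup :: "nat \<Rightarrow> 'a set \<Rightarrow> ('a, 'b) monoid_scheme \<Rightarrow> bool" where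
  "sylow_subgroup p T G \<longleftrightarrow> subgroup T G \<and> card T = p ^ multiplicity p (order G)"

text \<open>Conjugation acts on the right: \<open>conj_by G g x\<close> is \<open>x\<^sup>g = g\<inverse> x g\<close>.\<close>

definition conj_by :: "('a, 'b) monoid_scheme \<Rightarrow> 'a \<Rightarrow> 'a \<Rightarrow> 'a" where
  "conj_by G g x = inv\<^bsub>G\<^esub> g \<otimes>\<^bsub>G\<^esub> x \<otimes>\<^bsub>G\<^esub> g"

text \<open>That \<open>X\<close> is a \<open>p\<close>-subgroup of \<open>H\<close> follows from its lying in a Sylow \<open>p\<close>-subgroup \<open>T\<close>.\<close>

definition strongly_closed :: "nat \<Rightarrow> 'a set \<Rightarrow> ('a, 'b) monoid_scheme \<Rightarrow> bool" where
  "strongly_closed p X H \<longleftrightarrow> subgroup X H \<and>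
     (\<exists>T. sylow_subgroup p T H \<and> X \<subseteq> T \<and>
        (\<forall>x\<in>X. \<forall>h\<in>carrier H. conj_by H h x \<in> T \<longrightarrow> conj_by H h x \<in> X))"

text \<open>
  A fusion system over \<open>S\<close> is stored as the group \<open>S\<close> together with its morphism sets
  \<open>Hom X Y\<close>, for \<open>X\<close>, \<open>Y\<close> subgroups of \<open>S\<close>. A morphism is represented by a function that is
  undefined outside its source (\<^const>\<open>extensional\<close>), so that equal morphisms are equal functions,
  and \<open>Hom X Y\<close> is empty if \<open>X\<close> or \<open>Y\<close> is not a subgroup of \<open>S\<close>. The category axioms
  are not part of the record; the definitions below do not depend on them.
\<close>

record 'a fusion = "'a monoid" +
  Hom :: "'a set \<Rightarrow> 'a set \<Rightarrow> ('a \<Rightarrow> 'a) set"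

definition fusion_of_group :: "'a set \<Rightarrow> ('a, 'b) monoid_scheme \<Rightarrow> 'a fusion" where
  "fusion_of_group S G =
     \<lparr>carrier = S, monoid.mult = monoid.mult G, one = one G,
      Hom = (\<lambda>X Y. {\<phi>. subgroup X G \<and> X \<subseteq> S \<and> subgroup Y G \<and> Y \<subseteq> S \<and>
        (\<exists>g\<in>carrier G. conj_by G g ` X \<subseteq> Y \<and> \<phi> = restrict (conj_by G g) X)})\<rparr>"

definition fusion_normalizer :: "'a fusion \<Rightarrow> 'a set \<Rightarrow> 'a fusion" where
  "fusion_normalizer F P =
     F\<lparr>carrier := normalizer F P,
       Hom := (\<lambda>X Y. {\<phi> \<in> Hom F X Y. X \<subseteq> normalizer F P \<and> Y \<subseteq> normalizer F P \<and>
         (\<exists>\<psi>\<in>Hom F (X <#>\<^bsub>F\<^esub> P) (Y <#>\<^bsub>F\<^esub> P). (\<forall>x\<in>X. \<psi> x = \<phi> x) \<and> \<psi> ` P = P)})\<rparr>"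

definition fusion_subsystem :: "'a fusion \<Rightarrow> 'a fusion \<Rightarrow> bool" where
  "fusion_subsystem E F \<longleftrightarrow> carrier E \<subseteq> carrier F \<and> (\<forall>X Y. Hom E X Y \<subseteq> Hom F X Y)"

definition large_in_fusion :: "'a set \<Rightarrow> 'a fusion \<Rightarrow> bool" where
  "large_in_fusion Q F \<longleftrightarrow> subgroup Q F \<and> centralizer F Q \<subseteq> Q \<and>
     (\<forall>U. subgroup U F \<and> U \<noteq> {\<one>\<^bsub>F\<^esub>} \<and> U \<subseteq> center (F\<lparr>carrier := Q\<rparr>) \<longrightarrow>
        fusion_subsystem (fusion_normalizer F U) (fusion_normalizer F Q))"

end

theory Submission
  imports Defs "HOL-Algebra.Multiplicative_Group"
begin

text \<open>
  If \<open>Q\<close> is large, then \<open>Z(S)\<close> lies in \<open>Z(Q)\<close>, so \<open>S\<close> normalizes \<open>Q\<close>. Every non-trivial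
  \<open>U \<le> Z(Q)\<close> is conjugate under \<open>N\<^sub>G(Q)\<close> to some \<open>W\<close> for which \<open>N\<^sub>S(W)\<close> is a Sylow subgroup of
  \<open>N\<^sub>G(W)\<close>. As the fusion of \<open>N\<^sub>G(W)\<close> inside \<open>S\<close> is realized by \<open>N\<^sub>G(Q)\<close>, it preserves the
  characteristic subgroups of \<open>Q\<close>.

  Conversely, put \<open>N = N\<^sub>G(U)\<close> and let \<open>T\<close> be a Sylow subgroup of \<open>N\<close> containing \<open>N\<^sub>S(U)\<close>. The
  upper central series of \<open>Q\<close> consists of strongly closed subgroups, and this forces \<open>N\<^sub>N(Q)\<close> to
  control the fusion of \<open>N\<close> in \<open>T\<close>. The proof is a descending induction on \<open>|X|\<close>, for morphisms
  \<open>X \<rightarrow> T\<close>: one reduces to an automorphism of a fully normalized \<open>W\<close> that does not contain \<open>Q\<close>.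
  The elements of \<open>N\<^sub>N(W)\<close> stabilizing the chain that the series cuts out on \<open>W\<close> form a normal
  subgroup, which is a \<open>p\<close>-group modulo the centralizer of \<open>W\<close> and contains \<open>N\<^sub>Q(W)\<close>. By a Frattini
  argument for this subgroup the automorphism extends to a subgroup larger than \<open>W\<close>.
\<close>

subsection \<open>Finite \<open>p\<close>-groups and Sylow subgroups\<close>

text \<open>By the orbit-stabilizer theorem every orbit has p-power length. The orbits not made of
  fixed points have length larger than 1, so together they contribute a multiple of p.\<close>

lemma (in group_action) card_fixed_points_mod:
  assumes p: "prime p" and card: "order G = p ^ n" and fin: "finite E"
  shows "card E mod p = card {x \<in> E. \<forall>g\<in>carrier G. \<phi> g x = x} mod p"
proof -
  interpret group G
    using group_hom group_hom.axioms(1) by blast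
  let ?F = "{x \<in> E. \<forall>g\<in>carrier G. \<phi> g x = x}"
  let ?O = "{X \<in> orbits G E \<phi>. \<not> X \<subseteq> ?F}"
  have fixed: "orbit G \<phi> x = {x}" if "x \<in> ?F" for x
    using that one_closed unfolding orbit_def by force
  have subE: "X \<subseteq> E" if "X \<in> orbits G E \<phi>" for X
    using orbits_coverture that by blast
  have un: "\<Union>?O = E - ?F"
  proof (intro equalityI subsetI)
    fix y assume "y \<in> \<Union>?O"
    then obtain x where x: "x \<in> E" "y \<in> orbit G \<phi> x" "\<not> orbit G \<phi> x \<subseteq> ?F"
      unfolding orbits_def by auto
    then have y: "y \<in> E"
      using subE[of "orbit G \<phi> x"] unfolding orbits_def by blast
    moreover have "y \<notin> ?F"
    proof
      assume "y \<in> ?F"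
      then have "x = y"
        using fixed[of y] orbit_sym[OF x(1) y x(2)] by blast
      then show False
        using x(3) fixed[of y] \<open>y \<in> ?F\<close> by auto
    qed
    ultimately show "y \<in> E - ?F" by blast
  next
    fix y assume "y \<in> E - ?F"
    then show "y \<in> \<Union>?O"
      using orbit_refl[of y] unfolding orbits_def by blast
  qed
  have "p dvd card (\<Union>?O)"
  proof (rule dvd_partition)
    show "finite (\<Union>?O)"
      using un fin by simp
    show "\<forall>c\<in>?O. p dvd card c"
    proof
      fix c assume "c \<in> ?O"
      then obtain x where x: "x \<in> E" "c = orbit G \<phi> x" "\<not> c \<subseteq> ?F"
        unfolding orbits_def by auto
      have "card c * card (stabilizer G \<phi> x) = p ^ n"
        using orbit_stabilizer_theorem[OF x(1)] card x(2) by simp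
      then have "card c dvd p ^ n" by (metis dvd_triv_left)
      then obtain i where i: "card c = p ^ i"
        using divides_primepow_nat[OF p] by blast
      have "i \<noteq> 0"
      proof
        assume "i = 0"
        then have "card c = 1" using i by simp
        then have "c = {x}"
          using orbit_refl[OF x(1)] x(2) by (metis card_1_singletonE singletonD)
        then have "x \<in> ?F"
          using x(1,2) unfolding orbit_def by blast
        then show False using x(3) \<open>c = {x}\<close> by blast
      qed
      then show "p dvd card c" using i by simp
    qed
    show "\<forall>c1\<in>?O. \<forall>c2\<in>?O. c1 \<noteq> c2 \<longrightarrow> c1 \<inter> c2 = {}"
      using disjoint_union by blast
  qed
  then have "p dvd card (E - ?F)" using un by simp
  moreover have "card E = card ?F + card (E - ?F)"
    using fin card_Un_disjoint[of ?F "E - ?F"] by (simp add: Un_absorb1 subset_iff)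
  ultimately show ?thesis
    by (simp add: mod_add_eq[symmetric])
qed

locale finite_group_prime = group G for G (structure) +
  fixes p :: nat
  assumes finite_carrier [simp]: "finite (carrier G)" and prime_p: "prime p"
begin

text \<open>A version for actions given by a plain function and equations on \<open>E\<close>. Each
  \<open>f g\<close> is restricted to \<open>E\<close> because \<open>Bij\<close> consists of
  extensional functions.\<close>

lemma action_fixed_points_mod:
  assumes P: "subgroup P G" and card: "card P = p ^ n" and fin: "finite E"
    and closed: "\<And>g x. g \<in> P \<Longrightarrow> x \<in> E \<Longrightarrow> f g x \<in> E"
    and one: "\<And>x. x \<in> E \<Longrightarrow> f \<one> x = x"
    and comp: "\<And>g h x. g \<in> P \<Longrightarrow> h \<in> P \<Longrightarrow> x \<in> E \<Longrightarrow> f (g \<otimes> h) x = f g (f h x)"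
  shows "card E mod p = card {x \<in> E. \<forall>g\<in>P. f g x = x} mod p"
proof -
  interpret P: group "G\<lparr>carrier := P\<rparr>"
    using P by (rule subgroup_imp_group)
  have bij: "restrict (f g) E \<in> Bij E" if g: "g \<in> P" for g
  proof -
    have g': "inv g \<in> P" using g P by (simp add: subgroup.m_inv_closed)
    have gc: "g \<in> carrier G" using subgroup.mem_carrier[OF P g] .
    have "f (inv g) (f g x) = x" "f g (f (inv g) x) = x" if "x \<in> E" for x
      using comp[of "inv g" g x] comp[of g "inv g" x] one[of x] g g' gc that by auto
    then have "bij_betw (f g) E E"
      using closed g g' by (intro bij_betw_byWitness[where f' = "f (inv g)"]) auto
    then show ?thesis
      unfolding Bij_def by (metis (no_types, lifting) IntI bij_betw_cong mem_Collect_eq restrict_apply restrict_extensional)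
  qed
  interpret group_action "G\<lparr>carrier := P\<rparr>" E "\<lambda>g. restrict (f g) E"
  proof (rule group_action.intro)
    show "group_hom (G\<lparr>carrier := P\<rparr>) (BijGroup E) (\<lambda>g. restrict (f g) E)"
      unfolding group_hom_def group_hom_axioms_def
    proof (intro conjI P.is_group group_BijGroup homI)
      fix x y assume "x \<in> carrier (G\<lparr>carrier := P\<rparr>)" "y \<in> carrier (G\<lparr>carrier := P\<rparr>)"
      then show "restrict (f (x \<otimes>\<^bsub>G\<lparr>carrier := P\<rparr>\<^esub> y)) E =
          restrict (f x) E \<otimes>\<^bsub>BijGroup E\<^esub> restrict (f y) E"
        using bij[of x] bij[of y] comp closed
        by (auto simp: BijGroup_def compose_def restrict_def fun_eq_iff)
    qed (use bij in \<open>auto simp: BijGroup_def\<close>)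
  qed
  have "card E mod p = card {x \<in> E. \<forall>g\<in>carrier (G\<lparr>carrier := P\<rparr>). restrict (f g) E x = x} mod p"
    using card fin prime_p by (intro card_fixed_points_mod) (simp_all add: order_def)
  also have "{x \<in> E. \<forall>g\<in>carrier (G\<lparr>carrier := P\<rparr>). restrict (f g) E x = x} = {x \<in> E. \<forall>g\<in>P. f g x = x}"
    by auto
  finally show ?thesis .
qed

lemma finite_subgroup: "subgroup H G \<Longrightarrow> finite H"
  by (meson finite_carrier finite_subset subgroup.subset)

lemma card_rcosets_subgroup:
  assumes "subgroup K G" "subgroup H G" "H \<subseteq> K"
  shows "card ((\<lambda>k. H #> k) ` K) * card H = card K"
proof -
  interpret K: group "G\<lparr>carrier := K\<rparr>"
    using assms(1) by (rule subgroup_imp_group)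
  have "subgroup H (G\<lparr>carrier := K\<rparr>)"
    using assms by (simp add: subgroup_incl)
  then have "card (rcosets\<^bsub>G\<lparr>carrier := K\<rparr>\<^esub> H) * card H = card K"
    using K.lagrange by (simp add: order_def)
  moreover have "rcosets\<^bsub>G\<lparr>carrier := K\<rparr>\<^esub> H = (\<lambda>k. H #> k) ` K"
    unfolding RCOSETS_def r_coset_def by auto
  ultimately show ?thesis by simp
qed

text \<open>\<open>P\<close> acts on the right cosets of \<open>H\<close> in \<open>K\<close> by
  right multiplication. The inverse turns this into a left action, as
  \<open>action_fixed_points_mod\<close> demands.\<close>

lemma rcoset_fixed_points:
  assumes K: "subgroup K G" and H: "subgroup H G" and P: "subgroup P G"
    and sub: "H \<subseteq> K" "P \<subseteq> K" and card: "card P = p ^ n"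
  shows "card ((\<lambda>k. H #> k) ` K) mod p =
    card {A \<in> (\<lambda>k. H #> k) ` K. \<forall>x\<in>P. A #> inv x = A} mod p"
proof (rule action_fixed_points_mod[OF P card])
  have Kc: "K \<subseteq> carrier G" and Hc: "H \<subseteq> carrier G"
    using K H subgroup.subset by auto
  show "finite ((\<lambda>k. H #> k) ` K)"
    using finite_subgroup[OF K] by simp
  show "A #> inv x \<in> (\<lambda>k. H #> k) ` K" if xA: "x \<in> P" "A \<in> (\<lambda>k. H #> k) ` K" for x A
  proof -
    obtain k where k: "k \<in> K" "A = H #> k" using xA(2) by blast
    have x: "x \<in> K" using xA sub by blast
    have "A #> inv x = H #> (k \<otimes> inv x)"
      using k x Kc Hc by (simp add: coset_mult_assoc subset_iff)
    moreover have "k \<otimes> inv x \<in> K"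
      using k x K by (simp add: subgroup.m_closed subgroup.m_inv_closed)
    ultimately show ?thesis by blast
  qed
  fix A assume "A \<in> (\<lambda>k. H #> k) ` K"
  then have A: "A \<subseteq> carrier G" using Hc Kc r_coset_subset_G by blast
  then show "A #> inv \<one> = A" by simp
  fix g h assume "g \<in> P" "h \<in> P"
  then have "g \<in> carrier G" "h \<in> carrier G" using sub Kc by auto
  then show "A #> inv (g \<otimes> h) = A #> inv h #> inv g"
    using A by (simp add: coset_mult_assoc inv_mult_group)
qed

section \<open>Conjugation and normalizers\<close>

lemma conj_by_closed [simp]: "g \<in> carrier G \<Longrightarrow> x \<in> carrier G \<Longrightarrow> conj_by G g x \<in> carrier G"
  by (simp add: conj_by_def)

lemma conj_by_one [simp]: "x \<in> carrier G \<Longrightarrow> conj_by G \<one> x = x"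
  by (simp add: conj_by_def)

lemma conj_by_mult:
  "g \<in> carrier G \<Longrightarrow> h \<in> carrier G \<Longrightarrow> x \<in> carrier G \<Longrightarrow>
    conj_by G (g \<otimes> h) x = conj_by G h (conj_by G g x)"
  by (simp add: conj_by_def inv_mult_group m_assoc)

lemma conj_by_inv_cancel [simp]:
  "g \<in> carrier G \<Longrightarrow> x \<in> carrier G \<Longrightarrow> conj_by G (inv g) (conj_by G g x) = x"
  "g \<in> carrier G \<Longrightarrow> x \<in> carrier G \<Longrightarrow> conj_by G g (conj_by G (inv g) x) = x"
  by (simp_all flip: conj_by_mult)

lemma conj_by_distrib:
  assumes "g \<in> carrier G" "x \<in> carrier G" "y \<in> carrier G"
  shows "conj_by G g (x \<otimes> y) = conj_by G g x \<otimes> conj_by G g y"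
proof -
  have "g \<otimes> (inv g \<otimes> (y \<otimes> g)) = y \<otimes> g"
    using assms by (simp flip: m_assoc)
  then show ?thesis
    using assms by (simp add: conj_by_def m_assoc)
qed

lemma conj_by_inv:
  "g \<in> carrier G \<Longrightarrow> x \<in> carrier G \<Longrightarrow> conj_by G g (inv x) = inv (conj_by G g x)"
  by (simp add: conj_by_def inv_mult_group m_assoc)

lemma conj_by_conj_by:
  assumes "g \<in> carrier G" "h \<in> carrier G" "x \<in> carrier G"
  shows "conj_by G (conj_by G g h) x = conj_by G g (conj_by G h (conj_by G (inv g) x))"
  using assms by (simp add: conj_by_def inv_mult_group m_assoc)

lemma conj_by_hom: "g \<in> carrier G \<Longrightarrow> group_hom G G (conj_by G g)"
  by (simp add: group_hom_def group_hom_axioms_def hom_def conj_by_distrib is_group)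

lemma conj_by_inj: "g \<in> carrier G \<Longrightarrow> A \<subseteq> carrier G \<Longrightarrow> inj_on (conj_by G g) A"
  by (rule inj_on_inverseI[where g = "conj_by G (inv g)"]) auto

lemma conj_by_subgroup: "g \<in> carrier G \<Longrightarrow> subgroup H G \<Longrightarrow> subgroup (conj_by G g ` H) G"
  using conj_by_hom group_hom.subgroup_img_is_subgroup by blast

lemma conj_by_image_mult:
  assumes "g \<in> carrier G" "h \<in> carrier G" "A \<subseteq> carrier G"
  shows "conj_by G (g \<otimes> h) ` A = conj_by G h ` conj_by G g ` A"
  using assms by (auto simp: image_iff conj_by_mult subset_iff)

lemma conj_by_image_cancel [simp]:
  assumes "g \<in> carrier G" "A \<subseteq> carrier G"
  shows "conj_by G (inv g) ` conj_by G g ` A = A" "conj_by G g ` conj_by G (inv g) ` A = A"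
  using assms by (force simp: image_iff subset_iff)+

lemma conj_by_image_carrier:
  "g \<in> carrier G \<Longrightarrow> A \<subseteq> carrier G \<Longrightarrow> conj_by G g ` A \<subseteq> carrier G"
  by auto

lemma card_conj_by_image: "g \<in> carrier G \<Longrightarrow> A \<subseteq> carrier G \<Longrightarrow> card (conj_by G g ` A) = card A"
  by (simp add: card_image conj_by_inj)

lemma conj_by_mem:
  assumes "subgroup H G" "g \<in> H" "x \<in> H"
  shows "conj_by G g x \<in> H"
  using assms by (simp add: conj_by_def subgroup.m_closed subgroup.m_inv_closed)

lemma conj_by_self:
  assumes "subgroup H G" "g \<in> H"
  shows "conj_by G g ` H = H"
proof (rule card_subset_eq)
  show "conj_by G g ` H \<subseteq> H" using conj_by_mem[OF assms] by auto
  show "card (conj_by G g ` H) = card H"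
    using assms card_conj_by_image subgroup.subset subgroup.mem_carrier by metis
qed (rule finite_subgroup[OF assms(1)])

text \<open>The library normalizer is phrased with g A g^-1, which is conjugation by
  \<open>inv g\<close> in the convention of \<open>conj_by\<close>. Both conditions agree because
  the two conjugations undo each other.\<close>

lemma mem_normalizer_iff:
  assumes A: "A \<subseteq> carrier G"
  shows "g \<in> normalizer G A \<longleftrightarrow> g \<in> carrier G \<and> conj_by G g ` A = A"
proof (cases "g \<in> carrier G")
  case True
  have "g <# A #> inv g = conj_by G (inv g) ` A"
    using True A by (auto simp: l_coset_def r_coset_def conj_by_def)
  moreover have "conj_by G (inv g) ` A = A \<longleftrightarrow> conj_by G g ` A = A"
    using conj_by_image_cancel[OF True A] by metis
  ultimately show ?thesis
    using True A by (simp add: normalizer_def stabilizer_def)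
qed (simp add: normalizer_def stabilizer_def)

text \<open>Conjugation is injective and \<open>A\<close> is finite, so one inclusion forces
  equality.\<close>

lemma mem_normalizerI:
  assumes "A \<subseteq> carrier G" "g \<in> carrier G" "conj_by G g ` A \<subseteq> A"
  shows "g \<in> normalizer G A"
  using assms card_subset_eq[of A "conj_by G g ` A"] finite_subset[OF assms(1)]
  by (simp add: mem_normalizer_iff card_conj_by_image)

lemma normalizer_subgroup: "A \<subseteq> carrier G \<Longrightarrow> subgroup (normalizer G A) G"
  by (rule normalizer_imp_subgroup)

lemma subgroup_le_normalizer: "subgroup H G \<Longrightarrow> H \<subseteq> normalizer G H"
  by (auto simp: mem_normalizer_iff subgroup.subset subgroup.mem_carrier conj_by_self)

lemma normalizer_conj_by:
  assumes A: "A \<subseteq> carrier G" and g: "g \<in> carrier G"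
  shows "normalizer G (conj_by G g ` A) = conj_by G g ` normalizer G A"
proof -
  \<comment> \<open>One inclusion, for all \<open>B\<close> and \<open>g\<close>; used with the
    inverse of \<open>g\<close> it yields the other one.\<close>
  have *: "conj_by G g ` normalizer G B \<subseteq> normalizer G (conj_by G g ` B)"
    if B: "B \<subseteq> carrier G" and g: "g \<in> carrier G" for B g
  proof
    fix y assume "y \<in> conj_by G g ` normalizer G B"
    then obtain n where n: "n \<in> carrier G" "conj_by G n ` B = B" "y = conj_by G g n"
      using B by (auto simp: mem_normalizer_iff)
    have "conj_by G y ` conj_by G g ` B = conj_by G (g \<otimes> y) ` B"
      using n g B by (simp add: conj_by_image_mult)
    also have "g \<otimes> y = n \<otimes> g"
      using n g by (simp add: conj_by_def flip: m_assoc)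
    finally show "y \<in> normalizer G (conj_by G g ` B)"
      using n g B by (simp add: conj_by_image_mult mem_normalizer_iff conj_by_image_carrier)
  qed
  have "normalizer G (conj_by G g ` A) =
      conj_by G g ` conj_by G (inv g) ` normalizer G (conj_by G g ` A)"
    using A g by (simp add: normalizer_subgroup subgroup.subset conj_by_image_carrier)
  also have "\<dots> \<subseteq> conj_by G g ` normalizer G A"
    using *[of "conj_by G g ` A" "inv g"] A g by (auto simp: conj_by_image_carrier)
  finally show ?thesis
    using *[OF A g] by blast
qed

text \<open>H k x^-1 = H k amounts to k x k^-1 lying in \<open>H\<close>. Fixed cosets thus
  correspond to elements that conjugate \<open>P\<close> into \<open>H\<close>, which is how
  counting fixed points produces conjugations.\<close>

lemma rcoset_fixed_iff:
  assumes "subgroup H G" "subgroup P G" "k \<in> carrier G"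
  shows "(\<forall>x\<in>P. H #> k #> inv x = H #> k) \<longleftrightarrow> conj_by G (inv k) ` P \<subseteq> H"
proof -
  have "H #> k #> inv x = H #> k \<longleftrightarrow> conj_by G (inv k) x \<in> H" if "x \<in> P" for x
  proof -
    have x: "x \<in> carrier G" using subgroup.mem_carrier[OF assms(2) that] .
    have "H #> k #> inv x = H #> k \<longleftrightarrow> H #> (k \<otimes> inv x) = H #> k"
      using assms x by (simp add: coset_mult_assoc subgroup.subset)
    also have "\<dots> \<longleftrightarrow> k \<otimes> inv x \<otimes> inv k \<in> H"
    proof
      assume "H #> (k \<otimes> inv x) = H #> k"
      then have "H #> (k \<otimes> inv x \<otimes> inv k) = H"
        using assms(1,3) x coset_mult_inv2[of H "k \<otimes> inv x" k] by (simp add: subgroup.subset)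
      then show "k \<otimes> inv x \<otimes> inv k \<in> H"
        using assms(1,3) x coset_join1[of H] by simp
    next
      assume "k \<otimes> inv x \<otimes> inv k \<in> H"
      then have "H #> (k \<otimes> inv x \<otimes> inv k) = H"
        using assms(1,3) x by (simp add: subgroup.rcos_const)
      then show "H #> (k \<otimes> inv x) = H #> k"
        using assms(1,3) x coset_mult_inv1[of H "k \<otimes> inv x" k] by (simp add: subgroup.subset)
    qed
    also have "k \<otimes> inv x \<otimes> inv k = inv (conj_by G (inv k) x)"
      using assms(3) x by (simp add: conj_by_def inv_mult_group m_assoc)
    also have "\<dots> \<in> H \<longleftrightarrow> conj_by G (inv k) x \<in> H"
      using subgroup.m_inv_closed[OF assms(1), of "conj_by G (inv k) x"]
        subgroup.m_inv_closed[OF assms(1), of "inv (conj_by G (inv k) x)"] assms(3) x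
      by (auto simp: conj_by_def)
    finally show ?thesis .
  qed
  then show ?thesis by auto
qed

section \<open>p-subgroups and Sylow's theorems\<close>

definition p_subgroup :: "'a set \<Rightarrow> bool" where
  "p_subgroup P \<longleftrightarrow> subgroup P G \<and> (\<exists>n. card P = p ^ n)"

abbreviation sylow_in :: "'a set \<Rightarrow> 'a set \<Rightarrow> bool" where
  "sylow_in T K \<equiv> sylow_subgroup p T (G\<lparr>carrier := K\<rparr>)"

lemma p_subgroupD: "p_subgroup P \<Longrightarrow> subgroup P G"
  by (simp add: p_subgroup_def)

lemma sylow_in_iff:
  assumes "subgroup K G"
  shows "sylow_in T K \<longleftrightarrow> subgroup T G \<and> T \<subseteq> K \<and> card T = p ^ multiplicity p (card K)"
proof -
  have "subgroup T (G\<lparr>carrier := K\<rparr>) \<longleftrightarrow> subgroup T G \<and> T \<subseteq> K"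
    using incl_subgroup[OF assms] subgroup_incl[OF _ assms]
      subgroup.subset[of T "G\<lparr>carrier := K\<rparr>"] by auto
  then show ?thesis by (auto simp: sylow_subgroup_def order_def)
qed

lemma sylow_in_p_subgroup: "subgroup K G \<Longrightarrow> sylow_in T K \<Longrightarrow> p_subgroup T"
  by (auto simp: sylow_in_iff p_subgroup_def)

lemma subgroup_nat_pow_closed: "subgroup H G \<Longrightarrow> h \<in> H \<Longrightarrow> h [^] (n :: nat) \<in> H"
  using subgroup_int_pow_closed[of H h "int n"] by (simp add: int_pow_int)

lemma subgroup_pow_card:
  assumes "subgroup H G" "h \<in> H"
  shows "h [^] card H = \<one>"
proof -
  interpret H: group "G\<lparr>carrier := H\<rparr>" using assms(1) by (rule subgroup_imp_group)
  show ?thesis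
    using H.pow_order_eq_1[of h] assms(2) by (simp add: order_def flip: nat_pow_consistent)
qed

lemma card_subgroup_dvd:
  assumes "subgroup K G" "subgroup H G" "H \<subseteq> K"
  shows "card H dvd card K"
  using card_rcosets_subgroup[OF assms] by (metis dvd_triv_right)

lemma card_subgroup_pos: "subgroup H G \<Longrightarrow> card H > 0"
  using finite_subgroup subgroup.one_closed by (fastforce simp: card_gt_0_iff)

lemma p_subgroup_mono:
  assumes "p_subgroup P" "subgroup R G" "R \<subseteq> P"
  shows "p_subgroup R"
  using assms card_subgroup_dvd[of P R] divides_primepow_nat[OF prime_p]
  unfolding p_subgroup_def by metis

lemma p_subgroup_conj_by: "g \<in> carrier G \<Longrightarrow> p_subgroup P \<Longrightarrow> p_subgroup (conj_by G g ` P)"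
  using conj_by_subgroup card_conj_by_image subgroup.subset unfolding p_subgroup_def by metis

lemma sylow_exists:
  assumes K: "subgroup K G"
  obtains T where "sylow_in T K"
proof -
  have "p ^ multiplicity p (card K) dvd card K" by (rule multiplicity_dvd)
  then obtain m where "card K = p ^ multiplicity p (card K) * m" by (elim dvdE)
  then have "\<exists>T. subgroup T (G\<lparr>carrier := K\<rparr>) \<and> card T = p ^ multiplicity p (card K)"
    using K finite_subgroup[OF K] subgroup_imp_group prime_p
    by (intro sylow_thm) (auto simp: order_def)
  then show thesis
    using that by (auto simp: sylow_subgroup_def order_def)
qed

lemma sylow_in_conj_by:
  assumes K: "subgroup K G" and T: "sylow_in T K" and g: "g \<in> carrier G"
  shows "sylow_in (conj_by G g ` T) (conj_by G g ` K)"
  using T conj_by_subgroup[OF g] card_conj_by_image[OF g] K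
  by (auto simp: sylow_in_iff subgroup.subset)

text \<open>The index of \<open>T\<close> in \<open>K\<close> is prime to p, so \<open>P\<close>
  fixes some coset \<open>T #> k\<close> under right multiplication. By
  \<open>rcoset_fixed_iff\<close> the inverse of \<open>k\<close> then conjugates \<open>P\<close>
  into \<open>T\<close>.\<close>

theorem p_subgroup_conj_into_sylow:
  assumes K: "subgroup K G" and T: "sylow_in T K" and P: "p_subgroup P" "P \<subseteq> K"
  obtains k where "k \<in> K" "conj_by G k ` P \<subseteq> T"
proof -
  have T': "subgroup T G" "T \<subseteq> K" "card T = p ^ multiplicity p (card K)"
    using T K by (auto simp: sylow_in_iff)
  obtain n where n: "subgroup P G" "card P = p ^ n"
    using P by (auto simp: p_subgroup_def)
  let ?E = "(\<lambda>k. T #> k) ` K"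
  have prod: "card ?E * p ^ multiplicity p (card K) = card K"
    using card_rcosets_subgroup[OF K T'(1,2)] T'(3) by simp
  have "\<not> p dvd card ?E"
  proof
    assume "p dvd card ?E"
    then have "p ^ Suc (multiplicity p (card K)) dvd card K"
      using prod by (metis mult_dvd_mono dvd_refl power_Suc)
    then show False
      using card_subgroup_pos[OF K] prime_p
      by (metis multiplicity_geI Suc_n_not_le_n not_prime_unit not_gr_zero)
  qed
  then have "card {A \<in> ?E. \<forall>x\<in>P. A #> inv x = A} mod p \<noteq> 0"
    using rcoset_fixed_points[OF K T'(1) n(1) T'(2) P(2) n(2)] by (simp add: dvd_eq_mod_eq_0)
  then have "{A \<in> ?E. \<forall>x\<in>P. A #> inv x = A} \<noteq> {}" by (metis card.empty mod_0)
  then obtain k where k: "k \<in> K" "\<forall>x\<in>P. T #> k #> inv x = T #> k" by blast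
  then have "conj_by G (inv k) ` P \<subseteq> T"
    using rcoset_fixed_iff[OF T'(1) n(1)] K subgroup.mem_carrier by metis
  then show thesis
    using that[of "inv k"] k(1) K by (simp add: subgroup.m_inv_closed)
qed

text \<open>Conjugate \<open>P\<close> into some Sylow subgroup and then conjugate that Sylow
  subgroup back.\<close>

corollary sylow_containing:
  assumes K: "subgroup K G" and P: "p_subgroup P" "P \<subseteq> K"
  obtains T where "sylow_in T K" "P \<subseteq> T"
proof -
  obtain T where T: "sylow_in T K" using sylow_exists[OF K] .
  obtain k where k: "k \<in> K" "conj_by G k ` P \<subseteq> T"
    using p_subgroup_conj_into_sylow[OF K T P] .
  have kc: "k \<in> carrier G" and Pc: "P \<subseteq> carrier G"
    using k K P by (auto simp: subgroup.mem_carrier subgroup.subset p_subgroup_def)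
  have "sylow_in (conj_by G (inv k) ` T) (conj_by G (inv k) ` K)"
    using sylow_in_conj_by K T kc by simp
  moreover have "conj_by G (inv k) ` K = K"
    using K k by (simp add: conj_by_self subgroup.m_inv_closed)
  moreover have "P \<subseteq> conj_by G (inv k) ` T"
    using image_mono[OF k(2), of "conj_by G (inv k)"] kc Pc by simp
  ultimately show thesis using that by simp
qed

section \<open>Growth of normalizers and of centers in p-groups\<close>

lemma card_ge_2_other_element:
  assumes "p dvd card F" "finite F" "a \<in> F"
  obtains b where "b \<in> F" "b \<noteq> a"
proof -
  have "card F \<noteq> 1" using assms(1) prime_p by (metis not_prime_unit)
  then have "F \<noteq> {a}" by auto
  then show thesis using that assms(3) by blast
qed

lemma p_dvd_card_rcosets:
  assumes "p_subgroup T" "subgroup X G" "X \<subset> T"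
  shows "p dvd card ((\<lambda>t. X #> t) ` T)"
proof -
  have T: "subgroup T G" using assms(1) by (rule p_subgroupD)
  have prod: "card ((\<lambda>t. X #> t) ` T) * card X = card T"
    using card_rcosets_subgroup[OF T assms(2)] assms(3) by blast
  moreover have "card X < card T"
    using assms(3) finite_subgroup[OF T] by (simp add: psubset_card_mono)
  ultimately have "card ((\<lambda>t. X #> t) ` T) \<noteq> 1" by auto
  moreover obtain n where "card T = p ^ n" using assms(1) by (auto simp: p_subgroup_def)
  then obtain i where "card ((\<lambda>t. X #> t) ` T) = p ^ i"
    using prod divides_primepow_nat[OF prime_p] by (metis dvd_triv_left)
  ultimately show ?thesis by (cases i) auto
qed

text \<open>Let \<open>X\<close> act on its right cosets in \<open>T\<close>. The number of fixed
  cosets is divisible by p, and \<open>X\<close> itself is fixed, so there is another fixed coset;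
  its elements normalize \<open>X\<close>.\<close>

theorem p_subgroup_normalizer_grows:
  assumes T: "p_subgroup T" and X: "subgroup X G" "X \<subset> T"
  obtains t where "t \<in> T" "t \<notin> X" "t \<in> normalizer G X"
proof -
  let ?E = "(\<lambda>t. X #> t) ` T"
  let ?F = "{A \<in> ?E. \<forall>x\<in>X. A #> inv x = A}"
  have Ts: "subgroup T G" using T by (rule p_subgroupD)
  obtain n where n: "card X = p ^ n"
    using p_subgroup_mono[OF T X(1)] X(2) by (auto simp: p_subgroup_def)
  have "p dvd card ?F"
    using rcoset_fixed_points[OF Ts X(1) X(1) _ _ n] p_dvd_card_rcosets[OF T X] X(2)
    by (simp add: dvd_eq_mod_eq_0 psubset_imp_subset)
  moreover have "finite ?F" using finite_subgroup[OF Ts] by simp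
  moreover have "X \<in> ?F"
  proof -
    have "X = X #> \<one>" using X(1) by (simp add: subgroup.subset)
    then have "X \<in> ?E" using subgroup.one_closed[OF Ts] by blast
    then show ?thesis using X(1) by (simp add: subgroup.rcos_const subgroup.m_inv_closed is_group)
  qed
  ultimately obtain A where "A \<in> ?F" "A \<noteq> X" by (rule card_ge_2_other_element)
  then obtain t where t: "t \<in> T" "X #> t \<noteq> X" "\<forall>x\<in>X. X #> t #> inv x = X #> t" by blast
  have tc: "t \<in> carrier G" using t(1) Ts subgroup.mem_carrier by metis
  have "t \<notin> X" using t(2) X(1) by (auto simp: subgroup.rcos_const is_group)
  moreover have "inv t \<in> normalizer G X"
    using t(3) rcoset_fixed_iff[OF X(1) X(1) tc] X(1) tc
    by (intro mem_normalizerI) (simp_all add: subgroup.subset)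
  then have "t \<in> normalizer G X"
    using normalizer_subgroup[OF subgroup.subset[OF X(1)]] tc subgroup.m_inv_closed
    by (metis inv_inv)
  ultimately show thesis using that t(1) by blast
qed

lemma conj_by_r_coset:
  assumes "g \<in> carrier G" "x \<in> carrier G" "M \<subseteq> carrier G"
  shows "conj_by G g ` (M #> x) = conj_by G g ` M #> conj_by G g x"
  using assms by (force simp: r_coset_def conj_by_distrib subset_iff image_iff)

text \<open>The quotient P/M has a non-trivial central element: \<open>P\<close> acts by conjugation
  on the cosets of \<open>M\<close>, the fixed cosets are the central elements of P/M, and their
  number is divisible by p. Working with cosets avoids the factor group.\<close>

theorem p_subgroup_central_mod:
  assumes P: "p_subgroup P" and M: "subgroup M G" "M \<subset> P" "P \<subseteq> normalizer G M"
  obtains x where "x \<in> P" "x \<notin> M" "\<And>g. g \<in> P \<Longrightarrow> conj_by G g x \<otimes> inv x \<in> M"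
proof -
  let ?E = "(\<lambda>t. M #> t) ` P"
  let ?F = "{A \<in> ?E. \<forall>g\<in>P. conj_by G (inv g) ` A = A}"
  have Ps: "subgroup P G" using P by (rule p_subgroupD)
  have Pc: "P \<subseteq> carrier G" and Mc: "M \<subseteq> carrier G"
    using Ps M subgroup.subset by auto
  have inorm: "conj_by G g ` M = M" if "g \<in> P" for g
    using that M(3) Mc mem_normalizer_iff by blast
  have coset: "conj_by G g ` (M #> x) = M #> conj_by G g x" if "g \<in> P" "x \<in> P" for g x
    using that conj_by_r_coset[of g x M] inorm Pc Mc by (simp add: subset_iff)
  obtain n where n: "card P = p ^ n" using P by (auto simp: p_subgroup_def)
  have Pinv: "inv g \<in> P" if "g \<in> P" for g using that Ps by (simp add: subgroup.m_inv_closed)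
  have "card ?E mod p = card ?F mod p"
  proof (rule action_fixed_points_mod[OF Ps n])
    show "finite ?E" using finite_subgroup[OF Ps] by simp
    show "conj_by G (inv g) ` A \<in> ?E" if "g \<in> P" "A \<in> ?E" for g A
      using that coset Pinv conj_by_mem[OF Ps] by auto
    fix A assume "A \<in> ?E"
    then have A: "A \<subseteq> carrier G" using Mc Pc r_coset_subset_G by blast
    then show "conj_by G (inv \<one>) ` A = A" by (auto simp: subset_iff image_iff)
    show "conj_by G (inv (g \<otimes> h)) ` A = conj_by G (inv g) ` conj_by G (inv h) ` A"
      if "g \<in> P" "h \<in> P" for g h
      using that A Pc by (simp add: inv_mult_group conj_by_image_mult subset_iff)
  qed
  then have "p dvd card ?F"
    using p_dvd_card_rcosets[OF P M(1,2)] by (simp add: dvd_eq_mod_eq_0)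
  moreover have "finite ?F" using finite_subgroup[OF Ps] by simp
  moreover have "M \<in> ?F"
  proof -
    have "M = M #> \<one>" using Mc by simp
    then have "M \<in> ?E" using subgroup.one_closed[OF Ps] by blast
    then show ?thesis using inorm Pinv by simp
  qed
  ultimately obtain A where "A \<in> ?F" "A \<noteq> M" by (rule card_ge_2_other_element)
  then obtain x where x: "x \<in> P" "M #> x \<noteq> M" "\<And>g. g \<in> P \<Longrightarrow> conj_by G (inv g) ` (M #> x) = M #> x"
    by blast
  have xc: "x \<in> carrier G" using x Pc by auto
  have "x \<notin> M" using x(2) M(1) by (auto simp: subgroup.rcos_const is_group)
  moreover have "conj_by G g x \<otimes> inv x \<in> M" if g: "g \<in> P" for g
  proof -
    have gc: "g \<in> carrier G" using g Pc by auto
    have "M #> conj_by G g x = M #> x"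
      using x(3)[OF Pinv[OF g]] coset[OF g x(1)] gc by simp
    then have "M #> (conj_by G g x \<otimes> inv x) = M"
      using coset_mult_inv2 gc xc Mc by simp
    then show ?thesis using coset_join1 M(1) gc xc by simp
  qed
  ultimately show thesis using that x(1) by blast
qed

text \<open>Some conjugate of \<open>P'\<close> lies in \<open>P\<close>, so \<open>P'\<close> is
  not larger than \<open>P\<close>.\<close>

lemma sylow_in_maximal:
  assumes K: "subgroup K G" and P: "sylow_in P K" and P': "p_subgroup P'" "P' \<subseteq> K" "P \<subseteq> P'"
  shows "P' = P"
proof -
  obtain k where k: "k \<in> K" "conj_by G k ` P' \<subseteq> P"
    using p_subgroup_conj_into_sylow[OF K P P'(1,2)] .
  have Ps: "subgroup P G" using K P by (simp add: sylow_in_iff)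
  have "card P' = card (conj_by G k ` P')"
    using k K P'(1) by (simp add: card_conj_by_image p_subgroupD subgroup.subset subgroup.mem_carrier)
  also have "\<dots> \<le> card P"
    using k(2) finite_subgroup[OF Ps] by (rule card_mono[rotated])
  finally show ?thesis
    using P'(3) finite_subgroup[OF p_subgroupD[OF P'(1)]] by (metis card_seteq)
qed

lemma set_mult_normalizer:
  assumes H: "subgroup H G" and N: "subgroup N G" and HN: "H \<subseteq> normalizer G N"
  shows "subgroup (H <#> N) G" "H <#> N = N <#> H"
proof -
  have sub: "subgroup (normalizer G N) G"
    using N by (simp add: normalizer_subgroup subgroup.subset)
  interpret M: group "G\<lparr>carrier := normalizer G N\<rparr>"
    using sub by (rule subgroup_imp_group)
  have nor: "N \<lhd> G\<lparr>carrier := normalizer G N\<rparr>"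
    using N by (rule subgroup_in_normalizer)
  have "subgroup H (G\<lparr>carrier := normalizer G N\<rparr>)"
    using H HN sub by (simp add: subgroup_incl)
  then have "subgroup (N <#> H) (G\<lparr>carrier := normalizer G N\<rparr>)"
    and eq: "H <#> N = N <#> H"
    using M.mult_norm_subgroup[OF nor] M.commut_normal[OF _ nor] by simp_all
  then show "subgroup (H <#> N) G" using incl_subgroup[OF sub] by simp
  show "H <#> N = N <#> H" by (rule eq)
qed

lemma subset_set_mult:
  assumes "subgroup H G" "subgroup K G"
  shows "H \<subseteq> H <#> K" "K \<subseteq> H <#> K"
proof -
  have "h \<otimes> \<one> \<in> H <#> K" if "h \<in> H" for h
    using that assms subgroup.one_closed by (fastforce simp: set_mult_def)
  then show "H \<subseteq> H <#> K"
    using assms(1) subgroup.mem_carrier r_one by (metis subsetI)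
  have "\<one> \<otimes> k \<in> H <#> K" if "k \<in> K" for k
    using that assms subgroup.one_closed by (fastforce simp: set_mult_def)
  then show "K \<subseteq> H <#> K"
    using assms(2) subgroup.mem_carrier l_one by (metis subsetI)
qed

lemma set_mult_subset_subgroup:
  assumes "subgroup L G" "H \<subseteq> L" "K \<subseteq> L"
  shows "H <#> K \<subseteq> L"
  using assms by (auto simp: set_mult_def intro: subgroup.m_closed)

lemma conj_by_set_mult:
  assumes "g \<in> carrier G" "H \<subseteq> carrier G" "K \<subseteq> carrier G"
  shows "conj_by G g ` (H <#> K) = conj_by G g ` H <#> conj_by G g ` K"
  using assms set_mult_hom[OF group_hom.homh[OF conj_by_hom]] by blast

subsection \<open>The upper central series\<close>

text \<open>The terms Z_n(Q) without factor groups: \<open>x\<close> is central modulo Z_n exactly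
  if all commutators \<open>conj_by G g x \<otimes> inv x\<close> lie in Z_n.\<close>

primrec upper_central :: "'a set \<Rightarrow> nat \<Rightarrow> 'a set" where
  "upper_central Q 0 = {\<one>}"
| "upper_central Q (Suc n) = {x \<in> Q. \<forall>g\<in>Q. conj_by G g x \<otimes> inv x \<in> upper_central Q n}"

lemma upper_central_subset: "subgroup Q G \<Longrightarrow> upper_central Q n \<subseteq> Q"
  by (cases n) (auto simp: subgroup.one_closed)

text \<open>An automorphism carries commutators to commutators, and by surjectivity every
  \<open>g\<close> in \<open>Q\<close> is some \<open>f h\<close>. This gives one inclusion by
  induction; finiteness gives equality.\<close>

lemma upper_central_auto:
  assumes Q: "subgroup Q G" and f: "f \<in> auto (G\<lparr>carrier := Q\<rparr>)"
  shows "f ` upper_central Q n = upper_central Q n"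
proof -
  interpret Q: group "G\<lparr>carrier := Q\<rparr>"
    using Q by (rule subgroup_imp_group)
  interpret f: group_hom "G\<lparr>carrier := Q\<rparr>" "G\<lparr>carrier := Q\<rparr>" f
    using f Q.is_group by (simp add: auto_def group_hom_def group_hom_axioms_def)
  have bij: "bij_betw f Q Q" using f by (simp add: auto_def Bij_def)
  have mult: "f (x \<otimes> y) = f x \<otimes> f y" if "x \<in> Q" "y \<in> Q" for x y
    using f.hom_mult that by simp
  have finv: "f (inv x) = inv (f x)" if "x \<in> Q" for x
    using f.hom_inv[of x] that f.hom_closed[of x] Q by (simp add: m_inv_consistent)
  have closed: "inv x \<in> Q" if "x \<in> Q" for x
    using that Q by (simp add: subgroup.m_inv_closed)
  have mclosed: "x \<otimes> y \<in> Q" if "x \<in> Q" "y \<in> Q" for x y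
    using that Q by (simp add: subgroup.m_closed)
  have fconj: "f (conj_by G g x \<otimes> inv x) = conj_by G (f g) (f x) \<otimes> inv (f x)"
    if "g \<in> Q" "x \<in> Q" for g x
    using that by (simp add: conj_by_def mult finv closed mclosed)
  have "f ` upper_central Q n \<subseteq> upper_central Q n"
  proof (induction n)
    case 0
    then show ?case using f.hom_one by simp
  next
    case (Suc n)
    show ?case
    proof (clarsimp, intro conjI ballI)
      fix x assume x: "x \<in> Q" "\<forall>g\<in>Q. conj_by G g x \<otimes> inv x \<in> upper_central Q n"
      show "f x \<in> Q" using f.hom_closed x(1) by simp
      fix g assume "g \<in> Q"
      then obtain h where "h \<in> Q" "g = f h" using bij by (auto simp: bij_betw_def)
      then show "conj_by G g (f x) \<otimes> inv (f x) \<in> upper_central Q n"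
        using fconj[of h x] x Suc by (metis image_subset_iff)
    qed
  qed
  then show ?thesis
    using bij upper_central_subset[OF Q] finite_subgroup[OF Q]
    by (metis bij_betw_def card_image card_subset_eq finite_subset inj_on_subset)
qed

text \<open>The restriction makes the map extensional, as membership in \<open>auto\<close>
  requires. This is what lets \<open>normalizer G Q\<close> act on characteristic subgroups of
  \<open>Q\<close>.\<close>

lemma conj_by_auto:
  assumes Q: "subgroup Q G" and k: "k \<in> normalizer G Q"
  shows "restrict (conj_by G k) Q \<in> auto (G\<lparr>carrier := Q\<rparr>)"
proof -
  have k': "k \<in> carrier G" "conj_by G k ` Q = Q" and Qc: "Q \<subseteq> carrier G"
    using k Q by (auto simp: mem_normalizer_iff subgroup.subset)
  have "bij_betw (restrict (conj_by G k) Q) Q Q"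
    using k' conj_by_inj[OF k'(1) Qc] by (simp add: bij_betw_def inj_on_restrict_eq)
  moreover have "restrict (conj_by G k) Q \<in> hom (G\<lparr>carrier := Q\<rparr>) (G\<lparr>carrier := Q\<rparr>)"
    using k' Qc Q by (auto simp: hom_def conj_by_distrib subset_iff subgroup.m_closed)
  ultimately show ?thesis by (simp add: auto_def Bij_def)
qed

lemma characteristic_conj_by:
  assumes Q: "subgroup Q G" and k: "k \<in> normalizer G Q"
    and C: "characteristic_subgroup C (G\<lparr>carrier := Q\<rparr>)"
  shows "conj_by G k ` C = C"
proof -
  have "C \<subseteq> Q"
    using C subgroup.subset[of C "G\<lparr>carrier := Q\<rparr>"] by (simp add: characteristic_subgroup_def)
  have "restrict (conj_by G k) Q ` C = C"
    using conj_by_auto[OF Q k] C unfolding characteristic_subgroup_def by blast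
  moreover from \<open>C \<subseteq> Q\<close> have "restrict (conj_by G k) Q ` C = conj_by G k ` C"
    by (intro image_cong) auto
  ultimately show ?thesis by simp
qed

lemma upper_central_normalizer:
  assumes Q: "subgroup Q G"
  shows "normalizer G Q \<subseteq> normalizer G (upper_central Q n)"
proof
  fix k assume k: "k \<in> normalizer G Q"
  have sub: "upper_central Q n \<subseteq> Q" using Q by (rule upper_central_subset)
  have "restrict (conj_by G k) Q ` upper_central Q n = upper_central Q n"
    using upper_central_auto[OF Q conj_by_auto[OF Q k]] .
  moreover have "restrict (conj_by G k) Q ` upper_central Q n = conj_by G k ` upper_central Q n"
    using sub by (intro image_cong) auto
  moreover have "k \<in> carrier G"
    using k Q by (simp add: mem_normalizer_iff subgroup.subset)
  ultimately show "k \<in> normalizer G (upper_central Q n)"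
    using sub subgroup.subset[OF Q] by (subst mem_normalizer_iff) auto
qed

lemma upper_central_subgroup:
  assumes Q: "subgroup Q G"
  shows "subgroup (upper_central Q n) G"
proof (induction n)
  case 0
  show ?case using triv_subgroup by simp
next
  case (Suc n)
  \<comment> \<open>The commutators of an inverse and of a product are expressed through those of
    the factors only up to conjugation by an element of \<open>Q\<close>; this fact absorbs the
    conjugation.\<close>
  have inv_conj: "conj_by G g z \<in> upper_central Q n" if "g \<in> Q" "z \<in> upper_central Q n" for g z
  proof -
    have "g \<in> normalizer G (upper_central Q n)"
      using that(1) upper_central_normalizer[OF Q] subgroup_le_normalizer[OF Q] by blast
    then show ?thesis
      using that(2) subgroup.subset[OF Suc] by (auto simp: mem_normalizer_iff)
  qed
  have c: "x \<in> carrier G" if "x \<in> Q" for x using that subgroup.mem_carrier[OF Q] by blast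
  show ?case
  proof (rule subgroupI)
    show "upper_central Q (Suc n) \<subseteq> carrier G" using c by auto
    have "\<one> \<in> upper_central Q (Suc n)"
      using subgroup.one_closed[OF Q] subgroup.one_closed[OF Suc] c by (auto simp: conj_by_def)
    then show "upper_central Q (Suc n) \<noteq> {}" by blast
  next
    fix a assume "a \<in> upper_central Q (Suc n)"
    then have a: "a \<in> Q" "\<And>g. g \<in> Q \<Longrightarrow> conj_by G g a \<otimes> inv a \<in> upper_central Q n" by auto
    have "conj_by G g (inv a) \<otimes> inv (inv a) \<in> upper_central Q n" if g: "g \<in> Q" for g
    proof -
      have "conj_by G g (inv a) \<otimes> inv (inv a) = inv (conj_by G a (conj_by G g a \<otimes> inv a))"
        using a(1) g by (simp add: c conj_by_inv) (simp add: c conj_by_def[of _ a] inv_mult_group m_assoc)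
      also have "\<dots> \<in> upper_central Q n"
        using subgroup.m_inv_closed[OF Suc] inv_conj[OF a(1)] a(2)[OF g] by blast
      finally show ?thesis .
    qed
    then show "inv a \<in> upper_central Q (Suc n)"
      using a(1) Q by (simp add: subgroup.m_inv_closed)
  next
    fix a b assume "a \<in> upper_central Q (Suc n)" "b \<in> upper_central Q (Suc n)"
    then have ab: "a \<in> Q" "b \<in> Q" "\<And>g. g \<in> Q \<Longrightarrow> conj_by G g a \<otimes> inv a \<in> upper_central Q n"
      "\<And>g. g \<in> Q \<Longrightarrow> conj_by G g b \<otimes> inv b \<in> upper_central Q n" by auto
    have "conj_by G g (a \<otimes> b) \<otimes> inv (a \<otimes> b) \<in> upper_central Q n" if g: "g \<in> Q" for g
    proof -
      let ?x = "conj_by G g a" and ?y = "conj_by G g b"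
      have xy: "?x \<in> carrier G" "?y \<in> carrier G" using g ab c by auto
      have "conj_by G g (a \<otimes> b) \<otimes> inv (a \<otimes> b) =
          (?x \<otimes> inv a) \<otimes> conj_by G (inv a) (?y \<otimes> inv b)"
      proof -
        have "(?x \<otimes> inv a) \<otimes> conj_by G (inv a) (?y \<otimes> inv b)
            = ?x \<otimes> (inv a \<otimes> (a \<otimes> (?y \<otimes> (inv b \<otimes> inv a))))"
          using xy ab by (simp add: c conj_by_def[of _ "inv a"] m_assoc)
        also have "\<dots> = ?x \<otimes> (?y \<otimes> (inv b \<otimes> inv a))"
          using xy ab by (simp add: c flip: m_assoc[of "inv a" a])
        finally show ?thesis
          using xy ab g by (simp add: c conj_by_distrib inv_mult_group m_assoc)
      qed
      also have "\<dots> \<in> upper_central Q n"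
        using subgroup.m_closed[OF Suc] ab(3)[OF g] ab(4)[OF g] inv_conj ab(1)
          subgroup.m_inv_closed[OF Q] by blast
      finally show ?thesis .
    qed
    then show "a \<otimes> b \<in> upper_central Q (Suc n)"
      using ab Q by (simp add: subgroup.m_closed)
  qed
qed

lemma upper_central_characteristic:
  assumes Q: "subgroup Q G"
  shows "characteristic_subgroup (upper_central Q n) (G\<lparr>carrier := Q\<rparr>)"
  using upper_central_auto[OF Q] upper_central_subgroup[OF Q] upper_central_subset[OF Q] Q
  by (simp add: characteristic_subgroup_def subgroup_incl)

lemma upper_central_mono:
  assumes Q: "subgroup Q G"
  shows "upper_central Q n \<subseteq> upper_central Q (Suc n)"
proof
  fix x assume x: "x \<in> upper_central Q n"
  have "conj_by G g x \<otimes> inv x \<in> upper_central Q n" if "g \<in> Q" for g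
  proof -
    have "g \<in> normalizer G (upper_central Q n)"
      using that upper_central_normalizer[OF Q] subgroup_le_normalizer[OF Q] by blast
    then have "conj_by G g x \<in> upper_central Q n"
      using x subgroup.subset[OF upper_central_subgroup[OF Q]] by (auto simp: mem_normalizer_iff)
    then show ?thesis
      using x upper_central_subgroup[OF Q] by (simp add: subgroup.m_closed subgroup.m_inv_closed)
  qed
  then show "x \<in> upper_central Q (Suc n)"
    using x upper_central_subset[OF Q] by auto
qed

text \<open>While the series has not reached \<open>Q\<close>, \<open>p_subgroup_central_mod\<close>
  makes each step strict. Hence the order of the n-th term exceeds n, which is impossible at
  \<open>n = card Q\<close>.\<close>

lemma upper_central_eventually:
  assumes Q: "p_subgroup Q"
  obtains m where "upper_central Q m = Q"
proof -
  have Qs: "subgroup Q G" using Q by (rule p_subgroupD)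
  have "upper_central Q n = Q \<or> card (upper_central Q n) > n" for n
  proof (induction n)
    case 0
    then show ?case by simp
  next
    case (Suc n)
    have sub: "upper_central Q n \<subseteq> upper_central Q (Suc n)" "upper_central Q (Suc n) \<subseteq> Q"
      using upper_central_mono[OF Qs] upper_central_subset[OF Qs] by auto
    show ?case
    proof (cases "upper_central Q n = Q")
      case True
      then show ?thesis using sub by blast
    next
      case False
      then have psub: "upper_central Q n \<subset> Q" using sub by auto
      have "Q \<subseteq> normalizer G (upper_central Q n)"
        using upper_central_normalizer[OF Qs] subgroup_le_normalizer[OF Qs] by blast
      then obtain x where "x \<in> Q" "x \<notin> upper_central Q n"
        "\<And>g. g \<in> Q \<Longrightarrow> conj_by G g x \<otimes> inv x \<in> upper_central Q n"
        using p_subgroup_central_mod[OF Q upper_central_subgroup[OF Qs] psub] by blast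
      then have "upper_central Q n \<subset> upper_central Q (Suc n)" using sub(1) by auto
      then have "card (upper_central Q n) < card (upper_central Q (Suc n))"
        using finite_subgroup[OF upper_central_subgroup[OF Qs]] by (intro psubset_card_mono)
      then show ?thesis using Suc False by simp
    qed
  qed
  from this[of "card Q"] have "upper_central Q (card Q) = Q"
    using upper_central_subset[OF Qs] finite_subgroup[OF Qs] card_mono leD by metis
  then show thesis by (rule that)
qed

end

subsection \<open>Control of fusion by a normalizer\<close>

text \<open>As \<open>d\<close> fixes \<open>z\<close>, each further conjugation by \<open>d\<close>
  contributes one more factor \<open>z\<close>. So \<open>d [^] j\<close> centralizes
  \<open>w\<close> as soon as \<open>z [^] j\<close> is trivial.\<close>

lemma (in finite_group_prime) conj_by_pow_commutator:
  assumes d: "d \<in> carrier G" and w: "w \<in> carrier G" and z: "z \<in> carrier G"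
    and dw: "conj_by G d w = z \<otimes> w" and dz: "conj_by G d z = z"
  shows "conj_by G (d [^] j) w = z [^] (j :: nat) \<otimes> w"
proof (induction j)
  case 0
  then show ?case using w by simp
next
  case (Suc j)
  have "conj_by G d (z [^] j) = z [^] j"
    using group_hom.hom_nat_pow[OF conj_by_hom[OF d] z] dz by simp
  then have "conj_by G d (z [^] j \<otimes> w) = z [^] j \<otimes> (z \<otimes> w)"
    using assms by (simp add: conj_by_distrib)
  then show ?case using Suc d w z by (simp add: conj_by_mult m_assoc)
qed

text \<open>The setting of the control theorem. The closure of \<open>V i\<close> under fusion of
  \<open>N\<close> in \<open>T\<close> makes \<open>local_norm W\<close> preserve every
  \<open>W \<inter> V i\<close>, and \<open>V_central\<close> says that \<open>Q\<close> acts
  trivially on the sections of the chain.\<close>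

locale central_strongly_closed_series = finite_group_prime G p for G (structure) and p +
  fixes N T Q :: "'a set" and V :: "nat \<Rightarrow> 'a set" and m :: nat
  assumes N: "subgroup N G" and T: "sylow_in T N" and Q: "subgroup Q G" "Q \<subseteq> T"
    and V: "\<And>i. subgroup (V i) G" "V 0 = {\<one>}" "V m = T"
    and V_closed: "\<And>i x h. x \<in> V i \<Longrightarrow> h \<in> N \<Longrightarrow> conj_by G h x \<in> T \<Longrightarrow> conj_by G h x \<in> V i"
    and Q_closed: "\<And>x h. x \<in> Q \<Longrightarrow> h \<in> N \<Longrightarrow> conj_by G h x \<in> T \<Longrightarrow> conj_by G h x \<in> Q"
    and V_central: "\<And>i x g. x \<in> V (Suc i) \<Longrightarrow> g \<in> Q \<Longrightarrow> i < m \<Longrightarrow> conj_by G g x \<otimes> inv x \<in> V i"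
begin

lemma T_p_subgroup: "p_subgroup T"
  using sylow_in_p_subgroup[OF N T] .

lemma T_subgroup: "subgroup T G" and T_subset: "T \<subseteq> N"
  using T N by (auto simp: sylow_in_iff)

lemma carrier_N: "x \<in> N \<Longrightarrow> x \<in> carrier G" and carrier_T: "x \<in> T \<Longrightarrow> x \<in> carrier G"
  using subgroup.mem_carrier[OF N] subgroup.mem_carrier[OF T_subgroup] by auto

section \<open>The stabilizer of the chain cut out on a subgroup of T\<close>

definition local_norm :: "'a set \<Rightarrow> 'a set" where
  "local_norm W = N \<inter> normalizer G W"

definition chain_stabilizer :: "'a set \<Rightarrow> 'a set" where
  "chain_stabilizer W =
     {n \<in> local_norm W. \<forall>i<m. \<forall>w\<in>W \<inter> V (Suc i). conj_by G n w \<otimes> inv w \<in> V i}"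

lemma local_norm_subgroup: "subgroup W G \<Longrightarrow> subgroup (local_norm W) G"
  unfolding local_norm_def
  using N by (intro subgroups_Inter_pair normalizer_subgroup) (auto simp: subgroup.subset)

lemma local_normD:
  assumes "n \<in> local_norm W" "W \<subseteq> T"
  shows "n \<in> N" "n \<in> carrier G" "conj_by G n ` W = W" "w \<in> W \<Longrightarrow> conj_by G n w \<in> W"
proof -
  have *: "n \<in> N" "n \<in> normalizer G W" "W \<subseteq> carrier G"
    using assms carrier_T by (auto simp: local_norm_def)
  then show "n \<in> N" "n \<in> carrier G" "conj_by G n ` W = W"
    by (auto simp: mem_normalizer_iff)
  then show "w \<in> W \<Longrightarrow> conj_by G n w \<in> W" by blast
qed

text \<open>The conjugate of \<open>w\<close> stays in \<open>W\<close>, hence in \<open>T\<close>,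
  so that strong closure of \<open>V i\<close> applies.\<close>

lemma local_norm_V:
  assumes "n \<in> local_norm W" "W \<subseteq> T" "w \<in> W \<inter> V i"
  shows "conj_by G n w \<in> W \<inter> V i"
  using assms local_normD[OF assms(1,2)] V_closed by blast

lemma chain_stabilizer_subgroup:
  assumes W: "subgroup W G" "W \<subseteq> T"
  shows "subgroup (chain_stabilizer W) G"
proof (rule subgroupI)
  have L: "subgroup (local_norm W) G" using W(1) by (rule local_norm_subgroup)
  have c: "w \<in> carrier G" if "w \<in> W" for w using that W(2) carrier_T by blast
  show "chain_stabilizer W \<subseteq> carrier G"
    using L by (auto simp: chain_stabilizer_def subgroup.mem_carrier)
  have "\<one> \<in> chain_stabilizer W"
    using subgroup.one_closed[OF L] subgroup.one_closed[OF V(1)] c by (simp add: chain_stabilizer_def)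
  then show "chain_stabilizer W \<noteq> {}" by blast
  show "inv a \<in> chain_stabilizer W" if a: "a \<in> chain_stabilizer W" for a
  proof -
    have aL: "a \<in> local_norm W" using a by (simp add: chain_stabilizer_def)
    then have iL: "inv a \<in> local_norm W" using L by (simp add: subgroup.m_inv_closed)
    have "conj_by G (inv a) w \<otimes> inv w \<in> V i" if w: "i < m" "w \<in> W \<inter> V (Suc i)" for i w
    proof -
      let ?w = "conj_by G (inv a) w"
      have w': "?w \<in> W \<inter> V (Suc i)" using local_norm_V[OF iL W(2) w(2)] .
      then have "conj_by G a ?w \<otimes> inv ?w \<in> V i"
        using a w(1) by (simp add: chain_stabilizer_def)
      then have "w \<otimes> inv ?w \<in> V i"
        using w(2) c local_normD(2)[OF aL W(2)] by simp
      then have "inv (w \<otimes> inv ?w) \<in> V i" using V(1) by (simp add: subgroup.m_inv_closed)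
      then show ?thesis using w(2) w' c by (simp add: inv_mult_group)
    qed
    then show ?thesis using iL by (simp add: chain_stabilizer_def)
  qed
  show "a \<otimes> b \<in> chain_stabilizer W" if a: "a \<in> chain_stabilizer W" and b: "b \<in> chain_stabilizer W" for a b
  proof -
    have aL: "a \<in> local_norm W" and bL: "b \<in> local_norm W"
      using a b by (auto simp: chain_stabilizer_def)
    have "conj_by G (a \<otimes> b) w \<otimes> inv w \<in> V i" if w: "i < m" "w \<in> W \<inter> V (Suc i)" for i w
    proof -
      let ?w = "conj_by G a w"
      have w': "?w \<in> W \<inter> V (Suc i)" using local_norm_V[OF aL W(2) w(2)] .
      have ab: "conj_by G b ?w \<otimes> inv ?w \<in> V i" "?w \<otimes> inv w \<in> V i"
        using a b w w' by (simp_all add: chain_stabilizer_def)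
      have cc: "w \<in> carrier G" "?w \<in> carrier G" "conj_by G b ?w \<in> carrier G" "a \<in> carrier G" "b \<in> carrier G"
        using w(2) w' c local_normD(2)[OF aL W(2)] local_normD(2)[OF bL W(2)] by auto
      have "inv ?w \<otimes> (?w \<otimes> inv w) = inv w"
        using cc by (simp flip: m_assoc)
      then have "conj_by G (a \<otimes> b) w \<otimes> inv w = (conj_by G b ?w \<otimes> inv ?w) \<otimes> (?w \<otimes> inv w)"
        using cc by (simp add: conj_by_mult m_assoc)
      then show ?thesis using ab V(1) by (simp add: subgroup.m_closed)
    qed
    then show ?thesis using aL bL L by (simp add: chain_stabilizer_def subgroup.m_closed)
  qed
qed

text \<open>By \<open>local_norm_V\<close> both \<open>h\<close> and its inverse preserve each
  \<open>W \<inter> V i\<close>, so the condition for \<open>d\<close> is transported to the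
  conjugate of \<open>d\<close>.\<close>

lemma chain_stabilizer_normal:
  assumes W: "subgroup W G" "W \<subseteq> T" and h: "h \<in> local_norm W"
  shows "conj_by G h ` chain_stabilizer W \<subseteq> chain_stabilizer W"
proof clarify
  have L: "subgroup (local_norm W) G" using W(1) by (rule local_norm_subgroup)
  have c: "w \<in> carrier G" if "w \<in> W" for w using that W(2) carrier_T by blast
  fix d assume d: "d \<in> chain_stabilizer W"
  then have dL: "d \<in> local_norm W" by (simp add: chain_stabilizer_def)
  have iL: "inv h \<in> local_norm W" using h L by (simp add: subgroup.m_inv_closed)
  have cc: "d \<in> carrier G" "h \<in> carrier G"
    using local_normD(2)[OF dL W(2)] local_normD(2)[OF h W(2)] by auto
  have "conj_by G (conj_by G h d) w \<otimes> inv w \<in> V i" if w: "i < m" "w \<in> W \<inter> V (Suc i)" for i w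
  proof -
    let ?w = "conj_by G (inv h) w"
    have wc: "w \<in> carrier G" using w c by blast
    have w': "?w \<in> W \<inter> V (Suc i)" using local_norm_V[OF iL W(2) w(2)] .
    then have "conj_by G d ?w \<otimes> inv ?w \<in> V i"
      using d w(1) by (simp add: chain_stabilizer_def)
    moreover have "conj_by G d ?w \<otimes> inv ?w \<in> W"
      using w' local_normD(4)[OF dL W(2)] W(1) by (simp add: subgroup.m_closed subgroup.m_inv_closed)
    ultimately have "conj_by G h (conj_by G d ?w \<otimes> inv ?w) \<in> V i"
      using local_norm_V[OF h W(2)] by blast
    also have "conj_by G h (conj_by G d ?w \<otimes> inv ?w) = conj_by G h (conj_by G d ?w) \<otimes> inv w"
      using cc wc by (simp add: conj_by_distrib conj_by_inv)
    also have "conj_by G h (conj_by G d ?w) = conj_by G (conj_by G h d) w"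
      using cc wc by (simp add: conj_by_conj_by)
    finally show ?thesis .
  qed
  then show "conj_by G h d \<in> chain_stabilizer W"
    using conj_by_mem[OF L h dL] by (simp add: chain_stabilizer_def)
qed

lemma chain_stabilizer_Q:
  assumes "subgroup W G" "W \<subseteq> T" "q \<in> Q" "q \<in> normalizer G W"
  shows "q \<in> chain_stabilizer W"
  using assms Q(2) T_subset V_central by (auto simp: chain_stabilizer_def local_norm_def)

text \<open>This makes the chain stabilizer a p-group modulo the centralizer of \<open>W\<close>.
  Induction along the chain: if a p-power \<open>e\<close> of \<open>d\<close> fixes
  \<open>W \<inter> V i\<close> pointwise, then for \<open>w\<close> in the next term the commutator
  \<open>z\<close> is fixed by \<open>e\<close>. Hence \<open>e [^] card W\<close> multiplies
  \<open>w\<close> by \<open>z [^] card W = \<one>\<close>, and \<open>card W\<close> is a power of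
  p.\<close>

lemma chain_stabilizer_pow_centralizes:
  assumes W: "subgroup W G" "W \<subseteq> T" and d: "d \<in> chain_stabilizer W"
  obtains k where "\<And>w. w \<in> W \<Longrightarrow> conj_by G (d [^] (p ^ k)) w = w"
proof -
  obtain a where a: "card W = p ^ a"
    using p_subgroup_mono[OF T_p_subgroup W] by (auto simp: p_subgroup_def)
  have D: "subgroup (chain_stabilizer W) G" using W by (rule chain_stabilizer_subgroup)
  have dc: "d \<in> carrier G" using d D subgroup.mem_carrier by metis
  have c: "w \<in> carrier G" if "w \<in> W" for w using that W(2) carrier_T by blast
  have "i \<le> m \<Longrightarrow> \<exists>k. \<forall>w\<in>W \<inter> V i. conj_by G (d [^] (p ^ k)) w = w" for i
  proof (induction i)
    case 0
    have "conj_by G (d [^] (p ^ k)) \<one> = \<one>" for k :: nat using dc by (simp add: conj_by_def)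
    then show ?case using V(2) by auto
  next
    case (Suc i)
    then obtain k where k: "\<And>w. w \<in> W \<inter> V i \<Longrightarrow> conj_by G (d [^] (p ^ k)) w = w" by auto
    define e where "e = d [^] (p ^ k)"
    have e: "e \<in> chain_stabilizer W" "e \<in> carrier G"
      using subgroup_nat_pow_closed[OF D d] dc by (auto simp: e_def)
    have "conj_by G (d [^] (p ^ (k + a))) w = w" if w: "w \<in> W \<inter> V (Suc i)" for w
    proof -
      define z where "z = conj_by G e w \<otimes> inv w"
      have zV: "z \<in> V i" using e(1) w Suc.prems by (simp add: z_def chain_stabilizer_def)
      have eL: "e \<in> local_norm W" using e(1) by (simp add: chain_stabilizer_def)
      have zW: "z \<in> W"
        using w W(1) local_normD(4)[OF eL W(2)] by (simp add: z_def subgroup.m_closed subgroup.m_inv_closed)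
      have ze: "conj_by G e z = z" using k[of z] zV zW by (simp add: e_def)
      have "conj_by G e w = z \<otimes> w"
        using w e(2) by (simp add: z_def c m_assoc)
      then have "conj_by G (e [^] card W) w = z [^] card W \<otimes> w"
        using conj_by_pow_commutator e(2) c zW w ze by simp
      also have "z [^] card W = \<one>" using W(1) zW by (rule subgroup_pow_card)
      also have "e [^] card W = d [^] (p ^ (k + a))"
        using dc by (simp add: e_def a nat_pow_pow power_add)
      finally show ?thesis using w c by simp
    qed
    then show ?case by blast
  qed
  then obtain k where "\<forall>w\<in>W \<inter> V m. conj_by G (d [^] (p ^ k)) w = w" by blast
  then show thesis using that[of k] V(3) W(2) by blast
qed

definition chain_centralizer :: "'a set \<Rightarrow> 'a set" where
  "chain_centralizer W = {c \<in> chain_stabilizer W. \<forall>w\<in>W. conj_by G c w = w}"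

lemma chain_centralizer_subgroup:
  assumes W: "subgroup W G" "W \<subseteq> T"
  shows "subgroup (chain_centralizer W) G"
proof (rule subgroupI)
  have D: "subgroup (chain_stabilizer W) G" using W by (rule chain_stabilizer_subgroup)
  have c: "w \<in> carrier G" if "w \<in> W" for w using that W(2) carrier_T by blast
  have dc: "d \<in> carrier G" if "d \<in> chain_stabilizer W" for d using that D subgroup.mem_carrier by metis
  show "chain_centralizer W \<subseteq> carrier G" using dc by (auto simp: chain_centralizer_def)
  show "chain_centralizer W \<noteq> {}"
    using subgroup.one_closed[OF D] c by (auto simp: chain_centralizer_def)
  show "inv a \<in> chain_centralizer W" if "a \<in> chain_centralizer W" for a
  proof -
    have a: "a \<in> chain_stabilizer W" "\<And>w. w \<in> W \<Longrightarrow> conj_by G a w = w"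
      using that by (auto simp: chain_centralizer_def)
    have "conj_by G (inv a) w = w" if "w \<in> W" for w
      using conj_by_inv_cancel(1)[of a w] a(2)[OF that] dc[OF a(1)] c[OF that] by simp
    then show ?thesis using a(1) D by (simp add: chain_centralizer_def subgroup.m_inv_closed)
  qed
  show "a \<otimes> b \<in> chain_centralizer W" if "a \<in> chain_centralizer W" "b \<in> chain_centralizer W" for a b
    using that D dc c by (simp add: chain_centralizer_def subgroup.m_closed conj_by_mult)
qed

lemma chain_centralizer_normal:
  assumes W: "subgroup W G" "W \<subseteq> T"
  shows "chain_stabilizer W \<subseteq> normalizer G (chain_centralizer W)"
proof
  have D: "subgroup (chain_stabilizer W) G" using W by (rule chain_stabilizer_subgroup)
  have c: "w \<in> carrier G" if "w \<in> W" for w using that W(2) carrier_T by blast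
  have dc: "d \<in> carrier G" if "d \<in> chain_stabilizer W" for d using that D subgroup.mem_carrier by metis
  fix d assume d: "d \<in> chain_stabilizer W"
  have "conj_by G d a \<in> chain_centralizer W" if "a \<in> chain_centralizer W" for a
  proof -
    have a: "a \<in> chain_stabilizer W" "\<And>w. w \<in> W \<Longrightarrow> conj_by G a w = w"
      using that by (auto simp: chain_centralizer_def)
    have "conj_by G (conj_by G d a) w = w" if w: "w \<in> W" for w
    proof -
      have "inv d \<in> local_norm W"
        using d D subgroup.m_inv_closed by (fastforce simp: chain_stabilizer_def)
      then have w': "conj_by G (inv d) w \<in> W" using local_normD(4)[OF _ W(2)] w by blast
      have "conj_by G (conj_by G d a) w = conj_by G d (conj_by G a (conj_by G (inv d) w))"
        using dc[OF d] dc[OF a(1)] c[OF w]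
        by (simp add: conj_by_conj_by)
      then show ?thesis using a(2)[OF w'] dc[OF d] c[OF w] by simp
    qed
    then show ?thesis using conj_by_mem[OF D d a(1)] by (simp add: chain_centralizer_def)
  qed
  then show "d \<in> normalizer G (chain_centralizer W)"
    using dc[OF d] chain_centralizer_subgroup[OF W]
    by (intro mem_normalizerI) (auto simp: subgroup.subset)
qed

text \<open>Bezout's identity writes \<open>x\<close> as a product of integer powers of
  \<open>x [^] a\<close> and \<open>x [^] b\<close>.\<close>

lemma coprime_pow_eq:
  assumes H: "subgroup H G" and x: "x \<in> carrier G" and xa: "x [^] (a::nat) \<in> H" and xb: "x [^] (b::nat) \<in> H"
    and ab: "coprime a b"
  shows "x \<in> H"
proof -
  obtain u v where uv: "u * int a + v * int b = 1"
    using bezout_int[of "int a" "int b"] ab by auto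
  have "x = x [^] (u * int a + v * int b)" using uv x by simp
  also have "\<dots> = (x [^] int a) [^] u \<otimes> (x [^] int b) [^] v"
    using x by (simp add: int_pow_mult int_pow_pow mult.commute)
  also have "\<dots> \<in> H"
    using xa xb H by (simp add: subgroup.m_closed subgroup_int_pow_closed int_pow_int)
  finally show ?thesis .
qed

text \<open>The order of the stabilizer divides that of the product, prime by prime. The p-part is
  provided by \<open>R\<close>. For another prime q, an element of a Sylow q-subgroup has q-power
  order while some p-power of it centralizes \<open>W\<close>; so it centralizes \<open>W\<close>
  itself.\<close>

lemma chain_stabilizer_factor:
  assumes W: "subgroup W G" "W \<subseteq> T" and R: "sylow_in R (chain_stabilizer W)"
  shows "chain_centralizer W <#> R = chain_stabilizer W"
proof -
  let ?D = "chain_stabilizer W" and ?C = "chain_centralizer W"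
  have D: "subgroup ?D G" using W by (rule chain_stabilizer_subgroup)
  have C: "subgroup ?C G" using W by (rule chain_centralizer_subgroup)
  have CD: "?C \<subseteq> ?D" by (auto simp: chain_centralizer_def)
  have R': "subgroup R G" "R \<subseteq> ?D" "card R = p ^ multiplicity p (card ?D)"
    using R D by (auto simp: sylow_in_iff)
  have RC: "R <#> ?C = ?C <#> R" and K: "subgroup (?C <#> R) G"
    using set_mult_normalizer[OF R'(1) C] chain_centralizer_normal[OF W] R'(2) by auto
  have KD: "?C <#> R \<subseteq> ?D" using D CD R'(2) by (rule set_mult_subset_subgroup)
  have "card ?D dvd card (?C <#> R)"
  proof (rule multiplicity_le_imp_dvd)
    show "card ?D \<noteq> 0" using card_subgroup_pos[OF D] by simp
    fix q :: nat assume q: "prime q"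
    have "q ^ multiplicity q (card ?D) dvd card (?C <#> R)"
    proof (cases "q = p")
      case True
      then show ?thesis using card_subgroup_dvd[OF K R'(1) subset_set_mult(2)[OF C R'(1)]] R'(3) by simp
    next
      case False
      \<comment> \<open>A second instance of the locale supplies Sylow theory for the prime
        q.\<close>
      interpret q: finite_group_prime G q by unfold_locales (simp_all add: q)
      obtain Y where "q.sylow_in Y ?D" using q.sylow_exists[OF D] .
      then have Y: "subgroup Y G" "Y \<subseteq> ?D" "card Y = q ^ multiplicity q (card ?D)"
        using D by (auto simp: q.sylow_in_iff)
      have "y \<in> ?C" if y: "y \<in> Y" for y
      proof -
        have yD: "y \<in> ?D" and yc: "y \<in> carrier G" using y Y by (auto simp: subgroup.mem_carrier)
        obtain k where "\<And>w. w \<in> W \<Longrightarrow> conj_by G (y [^] (p ^ k)) w = w"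
          using chain_stabilizer_pow_centralizes[OF W yD] by blast
        then have 1: "y [^] (p ^ k) \<in> ?C"
          using subgroup_nat_pow_closed[OF D yD] by (simp add: chain_centralizer_def)
        have "y [^] card Y = \<one>" using Y(1) y by (rule subgroup_pow_card)
        then have 2: "y [^] (q ^ multiplicity q (card ?D)) \<in> ?C"
          using Y(3) subgroup.one_closed[OF C] by simp
        have "coprime (p ^ k) (q ^ multiplicity q (card ?D))"
          using primes_coprime[OF prime_p q] False by simp
        then show ?thesis using coprime_pow_eq[OF C yc 1 2] by blast
      qed
      then have "Y \<subseteq> ?C <#> R" using subset_set_mult(1)[OF C R'(1)] by blast
      then show ?thesis using card_subgroup_dvd[OF K Y(1)] Y(3) by simp
    qed
    then show "multiplicity q (card ?D) \<le> multiplicity q (card (?C <#> R))"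
      using card_subgroup_pos[OF K] q by (intro multiplicity_geI) auto
  qed
  then have "card ?D \<le> card (?C <#> R)" using card_subgroup_pos[OF K] by (simp add: dvd_imp_le)
  then show ?thesis using KD finite_subgroup[OF D] by (simp add: card_seteq)
qed

section \<open>Extending morphisms and the descending induction\<close>

definition controlled :: "'a set \<Rightarrow> bool" where
  "controlled X \<longleftrightarrow> (\<forall>h\<in>N. conj_by G h ` X \<subseteq> T \<longrightarrow>
     (\<exists>k\<in>local_norm Q. \<forall>x\<in>X. conj_by G k x = conj_by G h x))"

text \<open>An element of \<open>local_norm W\<close> conjugates a Sylow subgroup \<open>R\<close>
  of the stabilizer into \<open>T\<close>, because \<open>W\<close> is fully normalized. The
  stabilizer is normal in \<open>local_norm W\<close>, so this conjugate is again one of its Sylow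
  subgroups and, being maximal, equals the intersection.\<close>

lemma sylow_inter_chain_stabilizer:
  assumes W: "subgroup W G" "W \<subseteq> T" and full: "sylow_in (T \<inter> normalizer G W) (local_norm W)"
  shows "sylow_in (T \<inter> chain_stabilizer W) (chain_stabilizer W)"
proof -
  let ?D = "chain_stabilizer W"
  have D: "subgroup ?D G" using W by (rule chain_stabilizer_subgroup)
  have L: "subgroup (local_norm W) G" using W(1) by (rule local_norm_subgroup)
  have DL: "?D \<subseteq> local_norm W" by (auto simp: chain_stabilizer_def)
  obtain R where R: "sylow_in R ?D" using sylow_exists[OF D] .
  then have RD: "R \<subseteq> ?D" using D by (simp add: sylow_in_iff)
  obtain h where h: "h \<in> local_norm W" "conj_by G h ` R \<subseteq> T \<inter> normalizer G W"
    using p_subgroup_conj_into_sylow[OF L full sylow_in_p_subgroup[OF D R]] RD DL by blast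
  have hc: "h \<in> carrier G" using h L by (simp add: subgroup.mem_carrier)
  have "h \<in> normalizer G ?D"
    using chain_stabilizer_normal[OF W h(1)] hc D by (intro mem_normalizerI) (auto simp: subgroup.subset)
  then have hD: "conj_by G h ` ?D = ?D" using D by (simp add: mem_normalizer_iff subgroup.subset)
  have syl: "sylow_in (conj_by G h ` R) ?D" using sylow_in_conj_by[OF D R hc] hD by simp
  have "subgroup (T \<inter> ?D) G" using T_subgroup D by (rule subgroups_Inter_pair)
  then have "p_subgroup (T \<inter> ?D)" using p_subgroup_mono[OF T_p_subgroup] by simp
  moreover have "conj_by G h ` R \<subseteq> T \<inter> ?D" using h(2) hD RD by blast
  ultimately have "T \<inter> ?D = conj_by G h ` R" using sylow_in_maximal[OF D syl] by simp
  then show ?thesis using syl by simp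
qed

text \<open>A Frattini argument: modulo the centralizer of \<open>W\<close>, every element of \<open>local_norm W\<close>
  normalizes a Sylow subgroup \<open>R\<close> of the chain stabilizer, so its action on \<open>W\<close> extends to \<open>W R\<close>,
  and \<open>W R\<close> is larger than \<open>W\<close> because \<open>R\<close> contains the normalizer of \<open>W\<close> in \<open>Q\<close>.\<close>

lemma controlled_fully_normalized:
  assumes W: "subgroup W G" "W \<subseteq> T" and full: "sylow_in (T \<inter> normalizer G W) (local_norm W)"
    and QW: "\<not> Q \<subseteq> W"
    and IH: "\<And>X. subgroup X G \<Longrightarrow> X \<subseteq> T \<Longrightarrow> card W < card X \<Longrightarrow> controlled X"
    and h: "h \<in> local_norm W"
  obtains k where "k \<in> local_norm Q" "\<And>w. w \<in> W \<Longrightarrow> conj_by G k w = conj_by G h w"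
proof -
  let ?D = "chain_stabilizer W" and ?C = "chain_centralizer W"
  define R where "R = T \<inter> ?D"
  have D: "subgroup ?D G" using W by (rule chain_stabilizer_subgroup)
  have L: "subgroup (local_norm W) G" using W(1) by (rule local_norm_subgroup)
  have CL: "?C \<subseteq> local_norm W" by (auto simp: chain_stabilizer_def chain_centralizer_def)
  have R: "sylow_in R ?D" unfolding R_def using W full by (rule sylow_inter_chain_stabilizer)
  then have Rs: "subgroup R G" "R \<subseteq> ?D" using D by (auto simp: sylow_in_iff)
  have RT: "R \<subseteq> T" by (simp add: R_def)
  have c: "x \<in> carrier G" if "x \<in> local_norm W" for x using that L by (simp add: subgroup.mem_carrier)
  have hD: "conj_by G h ` R \<subseteq> ?D" using chain_stabilizer_normal[OF W h] Rs(2) by blast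
  obtain d where d: "d \<in> ?D" "conj_by G d ` conj_by G h ` R \<subseteq> R"
    using p_subgroup_conj_into_sylow[OF D R p_subgroup_conj_by[OF c[OF h] sylow_in_p_subgroup[OF D R]] hD] .
  have "d \<in> ?C <#> R" using d(1) chain_stabilizer_factor[OF W R] by simp
  then obtain a r where ar: "a \<in> ?C" "r \<in> R" "d = a \<otimes> r" by (auto simp: set_mult_def)
  have rc: "r \<in> carrier G" using ar(2) Rs(1) by (simp add: subgroup.mem_carrier)
  have aL: "a \<in> local_norm W" using ar(1) CL by blast
  have Rc: "R \<subseteq> carrier G" using Rs(1) by (simp add: subgroup.subset)
  \<comment> \<open>The factor \<open>r\<close> normalizes \<open>R\<close>, so \<open>h\<close>
    followed by \<open>a\<close> alone already takes \<open>R\<close> into \<open>R\<close>. Since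
    \<open>a\<close> fixes \<open>W\<close> pointwise, \<open>n\<close> and \<open>h\<close> induce
    the same map on \<open>W\<close>.\<close>
  define n where "n = h \<otimes> a"
  have nL: "n \<in> local_norm W" using h aL L by (simp add: n_def subgroup.m_closed)
  have "conj_by G r ` conj_by G n ` R \<subseteq> R"
    using d(2) ar(3) c[OF h] c[OF aL] rc Rc
    by (simp add: n_def conj_by_image_mult conj_by_image_carrier)
  then have "conj_by G (inv r) ` conj_by G r ` conj_by G n ` R \<subseteq> conj_by G (inv r) ` R"
    by (rule image_mono)
  then have nR: "conj_by G n ` R \<subseteq> R"
    using rc c[OF nL] Rc conj_by_self[OF Rs(1), of "inv r"] ar(2) Rs(1)
    by (simp add: conj_by_image_carrier subgroup.m_inv_closed)
  have RN: "R \<subseteq> normalizer G W" using Rs(2) by (auto simp: chain_stabilizer_def local_norm_def)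
  let ?X = "R <#> W"
  have X: "subgroup ?X G" using set_mult_normalizer(1)[OF Rs(1) W(1) RN] .
  have XT: "?X \<subseteq> T" using T_subgroup RT W(2) by (rule set_mult_subset_subgroup)
  have WX: "W \<subseteq> ?X" using subset_set_mult(2)[OF Rs(1) W(1)] .
  have Wc: "W \<subseteq> carrier G" using W(1) by (rule subgroup.subset)
  have "conj_by G n ` ?X = conj_by G n ` R <#> W"
    using conj_by_set_mult[OF c[OF nL] Rc Wc] local_normD(3)[OF nL W(2)] by simp
  also have "\<dots> \<subseteq> T" using T_subgroup nR RT W(2) by (intro set_mult_subset_subgroup) auto
  finally have nX: "conj_by G n ` ?X \<subseteq> T" .
  \<comment> \<open>\<open>W\<close> normalizes \<open>Q\<close> and is proper in the p-group
    \<open>W <#> Q\<close>, so some \<open>t = w \<otimes> q\<close> outside \<open>W\<close>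
    normalizes \<open>W\<close>. Then \<open>q\<close> also normalizes \<open>W\<close> and lies in
    \<open>R\<close> but not in \<open>W\<close>.\<close>
  have "card W < card ?X"
  proof -
    have WQ: "W \<subseteq> normalizer G Q"
    proof
      fix w assume w: "w \<in> W"
      then have wT: "w \<in> T" using W(2) by blast
      have "conj_by G w ` Q \<subseteq> Q"
        using Q_closed wT T_subset Q(2) conj_by_mem[OF T_subgroup wT] by blast
      then show "w \<in> normalizer G Q"
        using carrier_T[OF wT] Q(1) by (intro mem_normalizerI) (auto simp: subgroup.subset)
    qed
    let ?Y = "W <#> Q"
    have Y: "subgroup ?Y G" using set_mult_normalizer(1)[OF W(1) Q(1) WQ] .
    have "?Y \<subseteq> T" using T_subgroup W(2) Q(2) by (rule set_mult_subset_subgroup)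
    then have Yp: "p_subgroup ?Y" using p_subgroup_mono[OF T_p_subgroup Y] by simp
    have "W \<subset> ?Y" using subset_set_mult[OF W(1) Q(1)] QW by blast
    then obtain t where t: "t \<in> ?Y" "t \<notin> W" "t \<in> normalizer G W"
      using p_subgroup_normalizer_grows[OF Yp W(1)] by blast
    then obtain w q where wq: "w \<in> W" "q \<in> Q" "t = w \<otimes> q" by (auto simp: set_mult_def)
    have wc: "w \<in> carrier G" "q \<in> carrier G" using wq Wc Q carrier_T by auto
    have "q \<notin> W" using wq t(2) W(1) by (auto simp: subgroup.m_closed)
    have "q = inv w \<otimes> t" using wq(3) wc by (simp flip: m_assoc)
    also have "\<dots> \<in> normalizer G W"
      using t(3) wq(1) subgroup_le_normalizer[OF W(1)] normalizer_subgroup[OF Wc]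
      by (meson subgroup.m_closed subgroup.m_inv_closed subsetD)
    finally have "q \<in> R"
      using chain_stabilizer_Q[OF W wq(2)] wq(2) Q(2) by (auto simp: R_def)
    then have "W \<subset> ?X" using WX subset_set_mult(1)[OF Rs(1) W(1)] \<open>q \<notin> W\<close> by blast
    then show ?thesis using finite_subgroup[OF X] by (simp add: psubset_card_mono)
  qed
  then have "controlled ?X" using IH X XT by blast
  then obtain k where k: "k \<in> local_norm Q" "\<And>x. x \<in> ?X \<Longrightarrow> conj_by G k x = conj_by G n x"
    using nX local_normD(1)[OF nL W(2)] unfolding controlled_def by blast
  have "conj_by G k w = conj_by G h w" if w: "w \<in> W" for w
  proof -
    have "conj_by G h w \<in> W" using local_normD(4)[OF h W(2) w] .
    then have "conj_by G n w = conj_by G h w"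
      using ar(1) w Wc c[OF h] c[OF aL] by (simp add: n_def conj_by_mult subset_iff chain_centralizer_def)
    then show ?thesis using k(2) WX w by auto
  qed
  then show thesis using that k(1) by blast
qed

text \<open>When \<open>Q\<close> is not in \<open>X\<close>, both \<open>X\<close> and its image
  are carried onto one fully normalized conjugate \<open>W\<close> by elements of
  \<open>local_norm Q\<close>. What remains is an automorphism of \<open>W\<close>, which
  \<open>controlled_fully_normalized\<close> handles.\<close>

theorem all_controlled:
  assumes "subgroup X G" "X \<subseteq> T"
  shows "controlled X"
  using assms
proof (induction "card T - card X" arbitrary: X rule: less_induct)
  case less
  note X = less.prems
  have IH: "controlled Y" if Y: "subgroup Y G" "Y \<subseteq> T" "card X < card Y" for Y
  proof -
    have "card Y \<le> card T" using Y(2) finite_subgroup[OF T_subgroup] by (simp add: card_mono)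
    then have "card T - card Y < card T - card X" using Y(3) by linarith
    then show ?thesis using less.hyps Y by blast
  qed
  have Qc: "Q \<subseteq> carrier G" and Xc: "X \<subseteq> carrier G"
    using Q(1) X(1) by (auto simp: subgroup.subset)
  have LQ: "subgroup (local_norm Q) G" using Q(1) by (rule local_norm_subgroup)
  have Q_norm: "h \<in> local_norm Q" if h: "h \<in> N" "conj_by G h ` Q \<subseteq> T" for h
  proof -
    have "conj_by G h ` Q \<subseteq> Q" using Q_closed h by blast
    then show ?thesis using h(1) carrier_N Qc by (simp add: local_norm_def mem_normalizerI)
  qed
  show ?case
  proof (cases "Q \<subseteq> X")
    \<comment> \<open>Here \<open>h\<close> takes \<open>Q\<close> into \<open>T\<close>, hence
      normalizes \<open>Q\<close> by strong closure, and \<open>k = h\<close> works.\<close>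
    case True
    show ?thesis unfolding controlled_def
    proof (intro ballI impI)
      fix h assume "h \<in> N" "conj_by G h ` X \<subseteq> T"
      then have "h \<in> local_norm Q" using Q_norm True by blast
      then show "\<exists>k\<in>local_norm Q. \<forall>x\<in>X. conj_by G k x = conj_by G h x" by blast
    qed
  next
    case QX: False
    have LX: "subgroup (local_norm X) G" using X(1) by (rule local_norm_subgroup)
    have "p_subgroup (T \<inter> normalizer G X)"
      using p_subgroup_mono[OF T_p_subgroup] subgroups_Inter_pair[OF T_subgroup normalizer_subgroup[OF Xc]] by simp
    moreover have "T \<inter> normalizer G X \<subseteq> local_norm X" using T_subset by (auto simp: local_norm_def)
    ultimately obtain P where P: "sylow_in P (local_norm X)" "T \<inter> normalizer G X \<subseteq> P"
      using sylow_containing[OF LX] by blast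
    have PN: "P \<subseteq> N" using P(1) LX by (auto simp: sylow_in_iff local_norm_def)
    obtain g where g: "g \<in> N" "conj_by G g ` P \<subseteq> T"
      using p_subgroup_conj_into_sylow[OF N T sylow_in_p_subgroup[OF LX P(1)] PN] .
    have gc: "g \<in> carrier G" using g(1) by (rule carrier_N)
    \<comment> \<open>\<open>P\<close> is Sylow in \<open>local_norm X\<close> and \<open>g\<close>
      moves it into \<open>T\<close>. Its image is a Sylow subgroup of \<open>local_norm W\<close>
      lying in \<open>T\<close>, so it equals \<open>T \<inter> normalizer G W\<close>; this is what
      makes \<open>W\<close> fully normalized.\<close>
    define W where "W = conj_by G g ` X"
    have W: "subgroup W G" unfolding W_def using gc X(1) by (rule conj_by_subgroup)
    have "X \<subseteq> P" using P(2) X subgroup_le_normalizer by blast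
    then have WT: "W \<subseteq> T" using g(2) by (auto simp: W_def)
    have Wc: "W \<subseteq> carrier G" using W by (rule subgroup.subset)
    have LW: "subgroup (local_norm W) G" using W by (rule local_norm_subgroup)
    have card_W: "card W = card X" unfolding W_def using gc Xc by (rule card_conj_by_image)
    have "local_norm W = conj_by G g ` N \<inter> conj_by G g ` normalizer G X"
      using gc Xc N g(1) by (simp add: local_norm_def W_def normalizer_conj_by conj_by_self)
    also have "\<dots> = conj_by G g ` local_norm X"
      unfolding local_norm_def
      using conj_by_inj[OF gc subset_refl] N Xc
      by (metis inj_on_image_Int normalizer_subgroup subgroup.subset)
    finally have LW_eq: "local_norm W = conj_by G g ` local_norm X" .
    have syl: "sylow_in (conj_by G g ` P) (local_norm W)"
      unfolding LW_eq using LX P(1) gc by (rule sylow_in_conj_by)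
    have TW: "p_subgroup (T \<inter> normalizer G W)" "T \<inter> normalizer G W \<subseteq> local_norm W"
      using p_subgroup_mono[OF T_p_subgroup] subgroups_Inter_pair[OF T_subgroup normalizer_subgroup[OF Wc]]
        T_subset by (auto simp: local_norm_def)
    have "conj_by G g ` P \<subseteq> T \<inter> normalizer G W"
      using g(2) syl LW by (auto simp: sylow_in_iff local_norm_def)
    then have "T \<inter> normalizer G W = conj_by G g ` P"
      using sylow_in_maximal[OF LW syl TW] by simp
    then have full: "sylow_in (T \<inter> normalizer G W) (local_norm W)"
      using syl by simp
    \<comment> \<open>Otherwise \<open>inv g\<close> would take \<open>Q\<close> into
      \<open>X \<le> T\<close>, hence normalize \<open>Q\<close>, and \<open>Q\<close> would lie in
      \<open>X\<close>.\<close>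
    have QW: "\<not> Q \<subseteq> W"
    proof
      assume "Q \<subseteq> W"
      then have "conj_by G (inv g) ` Q \<subseteq> X"
        using image_mono[of Q W "conj_by G (inv g)"] gc Xc by (simp add: W_def)
      moreover from this have "inv g \<in> local_norm Q"
        using Q_norm[of "inv g"] g(1) N X(2) by (auto simp: subgroup.m_inv_closed)
      ultimately show False
        using QX local_normD(3)[OF _ Q(2)] by auto
    qed
    \<comment> \<open>The map from \<open>Y\<close> onto \<open>W\<close> is extended to
      \<open>A\<close>, the normalizer of \<open>Y\<close> in \<open>T\<close>, after correcting
      \<open>u\<close> by some \<open>n\<close> in \<open>local_norm W\<close> so that the image of
      \<open>A\<close> lies in \<open>T\<close>. As \<open>A\<close> is larger than
      \<open>X\<close>, the induction hypothesis realizes \<open>u \<otimes> n\<close> on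
      \<open>A\<close> by an element of \<open>local_norm Q\<close>.\<close>
    have move: "\<exists>k\<in>local_norm Q. conj_by G k ` Y = W"
      if Y: "subgroup Y G" "Y \<subseteq> T" "u \<in> N" "conj_by G u ` Y = W" for Y u
    proof -
      have uc: "u \<in> carrier G" using Y(3) by (rule carrier_N)
      have Yc: "Y \<subseteq> carrier G" using Y(1) by (rule subgroup.subset)
      have card_Y: "card Y = card X" using card_conj_by_image[OF uc Yc] Y(4) card_W by simp
      have "Y \<noteq> T"
      proof
        assume "Y = T"
        then have "X = T"
          using X(2) finite_subgroup[OF T_subgroup] card_Y by (simp add: card_subset_eq)
        then show False using QX Q(2) by simp
      qed
      define A where "A = T \<inter> normalizer G Y"
      have A: "subgroup A G" "A \<subseteq> T"
        unfolding A_def using subgroups_Inter_pair[OF T_subgroup normalizer_subgroup[OF Yc]] by auto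
      have YA: "Y \<subseteq> A" using Y(2) subgroup_le_normalizer[OF Y(1)] by (simp add: A_def)
      obtain t where "t \<in> T" "t \<notin> Y" "t \<in> normalizer G Y"
        using p_subgroup_normalizer_grows[OF T_p_subgroup Y(1)] Y(2) \<open>Y \<noteq> T\<close> by blast
      then have "Y \<subset> A" using YA by (auto simp: A_def)
      then have card_A: "card X < card A"
        using finite_subgroup[OF A(1)] card_Y by (metis psubset_card_mono)
      have "conj_by G u ` A \<subseteq> N"
        using conj_by_mem[OF N Y(3)] A(2) T_subset by blast
      moreover have "conj_by G u ` A \<subseteq> normalizer G W"
        using normalizer_conj_by[OF Yc uc] Y(4) by (auto simp: A_def)
      ultimately have "conj_by G u ` A \<subseteq> local_norm W" by (simp add: local_norm_def)
      then obtain n where n: "n \<in> local_norm W" "conj_by G n ` conj_by G u ` A \<subseteq> T \<inter> normalizer G W"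
        using p_subgroup_conj_into_sylow[OF LW full p_subgroup_conj_by[OF uc p_subgroup_mono[OF T_p_subgroup A]]] by blast
      have nN: "n \<in> N" "n \<in> carrier G" using local_normD[OF n(1) WT] by auto
      have "conj_by G (u \<otimes> n) ` A \<subseteq> T"
        using n(2) uc nN A(1) by (simp add: conj_by_image_mult subgroup.subset)
      moreover have "u \<otimes> n \<in> N" using Y(3) nN N by (simp add: subgroup.m_closed)
      ultimately obtain k where k: "k \<in> local_norm Q" "\<forall>x\<in>A. conj_by G k x = conj_by G (u \<otimes> n) x"
        using IH[OF A card_A] unfolding controlled_def by blast
      have "conj_by G k ` Y = conj_by G (u \<otimes> n) ` Y" using k(2) YA by (intro image_cong) auto
      also have "\<dots> = W" using uc nN Yc Y(4) local_normD(3)[OF n(1) WT] by (simp add: conj_by_image_mult)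
      finally show ?thesis using k(1) by blast
    qed
    show ?thesis unfolding controlled_def
    proof (intro ballI impI)
      fix h assume h: "h \<in> N" "conj_by G h ` X \<subseteq> T"
      have hc: "h \<in> carrier G" using h(1) by (rule carrier_N)
      have hX: "subgroup (conj_by G h ` X) G" using hc X(1) by (rule conj_by_subgroup)
      obtain k1 where k1: "k1 \<in> local_norm Q" "conj_by G k1 ` X = W"
        using move[OF X g(1)] by (auto simp: W_def)
      have "conj_by G (inv h \<otimes> g) ` conj_by G h ` X = W"
        using hc gc Xc by (simp add: W_def conj_by_image_mult conj_by_image_carrier)
      then obtain k2 where k2: "k2 \<in> local_norm Q" "conj_by G k2 ` conj_by G h ` X = W"
        using move[OF hX h(2), of "inv h \<otimes> g"] h(1) g(1) N
        by (auto simp: subgroup.m_closed subgroup.m_inv_closed)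
      have kN: "k1 \<in> N" "k2 \<in> N" "k1 \<in> carrier G" "k2 \<in> carrier G"
        using local_normD(1,2)[OF k1(1) Q(2)] local_normD(1,2)[OF k2(1) Q(2)] by auto
      \<comment> \<open>The automorphism of \<open>W\<close> that \<open>h\<close> becomes after
        identifying \<open>X\<close> with \<open>W\<close> by \<open>k1\<close> and the image of
        \<open>X\<close> with \<open>W\<close> by \<open>k2\<close>. Once \<open>k3\<close> realizes
        \<open>n\<close>, the original map is that of
        \<open>k1 \<otimes> (k3 \<otimes> inv k2)\<close>.\<close>
      define n where "n = inv k1 \<otimes> (h \<otimes> k2)"
      have nc: "n \<in> carrier G" using kN hc by (simp add: n_def)
      have n_eq: "conj_by G n (conj_by G k1 x) = conj_by G k2 (conj_by G h x)" if "x \<in> carrier G" for x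
        using that kN hc by (simp add: n_def conj_by_mult)
      have "conj_by G n ` W = conj_by G k2 ` conj_by G h ` X"
        unfolding k1(2)[symmetric] image_image using n_eq Xc by (intro image_cong) auto
      then have "n \<in> normalizer G W" using nc Wc k2(2) by (simp add: mem_normalizer_iff)
      moreover have "n \<in> N" using kN h(1) N by (simp add: n_def subgroup.m_closed subgroup.m_inv_closed)
      ultimately have "n \<in> local_norm W" by (simp add: local_norm_def)
      then obtain k3 where k3: "k3 \<in> local_norm Q" "\<And>w. w \<in> W \<Longrightarrow> conj_by G k3 w = conj_by G n w"
        using controlled_fully_normalized[OF W WT full QW] IH card_W by metis
      have k3c: "k3 \<in> carrier G" using local_normD(2)[OF k3(1) Q(2)] .
      let ?k = "k1 \<otimes> (k3 \<otimes> inv k2)"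
      have "?k \<in> local_norm Q"
        using k1(1) k2(1) k3(1) LQ by (simp add: subgroup.m_closed subgroup.m_inv_closed)
      moreover have "conj_by G ?k x = conj_by G h x" if x: "x \<in> X" for x
      proof -
        have xc: "x \<in> carrier G" using x Xc by blast
        have "conj_by G ?k x = conj_by G (inv k2) (conj_by G k3 (conj_by G k1 x))"
          using xc kN k3c by (simp add: conj_by_mult)
        also have "conj_by G k3 (conj_by G k1 x) = conj_by G k2 (conj_by G h x)"
          using k3(2) k1(2) x n_eq[OF xc] by auto
        finally show ?thesis using kN hc xc by simp
      qed
      ultimately show "\<exists>k\<in>local_norm Q. \<forall>x\<in>X. conj_by G k x = conj_by G h x" by blast
    qed
  qed
qed

end

context finite_group_prime
begin

section \<open>From strongly closed characteristic subgroups to control of fusion\<close>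

lemma conj_by_consistent:
  "subgroup H G \<Longrightarrow> h \<in> H \<Longrightarrow> conj_by (G\<lparr>carrier := H\<rparr>) h x = conj_by G h x"
  by (simp add: conj_by_def m_inv_consistent)

text \<open>The definition offers only some Sylow subgroup \<open>U\<close>. An element
  \<open>k\<close> taking \<open>T\<close> into \<open>U\<close> takes \<open>C\<close> into
  \<open>U\<close>, hence normalizes \<open>C\<close> by closure in \<open>U\<close>. Closure is
  thus transported from \<open>U\<close> to \<open>T\<close>.\<close>

lemma strongly_closed_any_sylow:
  assumes H: "subgroup H G" and C: "strongly_closed p C (G\<lparr>carrier := H\<rparr>)"
    and T: "sylow_in T H" "C \<subseteq> T"
    and x: "x \<in> C" "h \<in> H" "conj_by G h x \<in> T"
  shows "conj_by G h x \<in> C"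
proof -
  obtain U where U: "sylow_in U H" "C \<subseteq> U"
    and closed: "\<And>x h. x \<in> C \<Longrightarrow> h \<in> H \<Longrightarrow> conj_by G h x \<in> U \<Longrightarrow> conj_by G h x \<in> C"
    using C conj_by_consistent[OF H] by (auto simp: strongly_closed_def)
  have TH: "T \<subseteq> H" using T(1) H by (simp add: sylow_in_iff)
  have Hc: "H \<subseteq> carrier G" using H by (rule subgroup.subset)
  have Cc: "C \<subseteq> carrier G" using T(2) TH Hc by blast
  obtain k where k: "k \<in> H" "conj_by G k ` T \<subseteq> U"
    using p_subgroup_conj_into_sylow[OF H U(1) sylow_in_p_subgroup[OF H T(1)] TH] .
  have kc: "k \<in> carrier G" and xc: "x \<in> carrier G" and hc: "h \<in> carrier G"
    using k(1) x(1,2) Hc Cc by auto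
  have "conj_by G k ` C \<subseteq> C" using closed k T(2) by blast
  then have kC: "conj_by G k ` C = C"
    using mem_normalizerI[OF Cc kc] mem_normalizer_iff[OF Cc] by blast
  have "conj_by G (h \<otimes> k) x \<in> U"
    using k(2) x(3) hc kc xc by (auto simp: conj_by_mult)
  then have "conj_by G (h \<otimes> k) x \<in> C"
    using closed[OF x(1)] x(2) k(1) H by (simp add: subgroup.m_closed)
  then have "conj_by G k (conj_by G h x) \<in> conj_by G k ` C"
    using kC hc kc xc by (simp add: conj_by_mult)
  then obtain c where c: "c \<in> C" "conj_by G k (conj_by G h x) = conj_by G k c" by blast
  then have "conj_by G h x = c"
    using conj_by_inj[OF kc, of "carrier G"] hc xc Cc by (auto dest: inj_onD)
  then show ?thesis using c(1) by simp
qed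

text \<open>The upper central series of \<open>Q\<close>, topped off by the whole Sylow subgroup, is the chain that the
  control theorem is applied to.\<close>

theorem control_of_characteristic_strongly_closed:
  assumes N: "subgroup N G" and T: "sylow_in T N" and Q: "subgroup Q G" "Q \<subseteq> T"
    and closed: "\<And>C. characteristic_subgroup C (G\<lparr>carrier := Q\<rparr>) \<Longrightarrow> strongly_closed p C (G\<lparr>carrier := N\<rparr>)"
    and X: "subgroup X G" "X \<subseteq> T" and h: "h \<in> N" "conj_by G h ` X \<subseteq> T"
  shows "\<exists>k\<in>N \<inter> normalizer G Q. \<forall>x\<in>X. conj_by G k x = conj_by G h x"
proof -
  have Ts: "subgroup T G" "T \<subseteq> N" using T N by (auto simp: sylow_in_iff)
  have Qp: "p_subgroup Q" using p_subgroup_mono[OF sylow_in_p_subgroup[OF N T] Q] .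
  obtain m where m: "upper_central Q m = Q" using upper_central_eventually[OF Qp] .
  have sub: "upper_central Q i \<subseteq> T" for i using upper_central_subset[OF Q(1)] Q(2) by blast
  have uc_closed: "conj_by G h x \<in> upper_central Q i"
    if "x \<in> upper_central Q i" "h \<in> N" "conj_by G h x \<in> T" for x h i
    using strongly_closed_any_sylow[OF N closed[OF upper_central_characteristic[OF Q(1)]] T sub that] .
  have Q_closed: "conj_by G h x \<in> Q" if "x \<in> Q" "h \<in> N" "conj_by G h x \<in> T" for x h
    using uc_closed[of x m h] that m by simp
  \<comment> \<open>This is the top section of the chain: \<open>Q\<close> is normal in
    \<open>T\<close>, so commutators of \<open>Q\<close> with \<open>T\<close> lie in
    \<open>Q\<close>.\<close>
  have QT: "conj_by G g x \<otimes> inv x \<in> Q" if "x \<in> T" "g \<in> Q" for x g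
  proof -
    have c: "x \<in> carrier G" "g \<in> carrier G"
      using that Ts(1) Q by (auto simp: subgroup.mem_carrier)
    have ix: "inv x \<in> T" using that(1) Ts(1) by (simp add: subgroup.m_inv_closed)
    then have "conj_by G (inv x) g \<in> Q"
      using Q_closed[of g "inv x"] that(2) Q(2) Ts conj_by_mem[OF Ts(1) ix] by blast
    then have "inv g \<otimes> conj_by G (inv x) g \<in> Q"
      using that(2) Q(1) by (simp add: subgroup.m_closed subgroup.m_inv_closed)
    then show ?thesis using c by (simp add: conj_by_def m_assoc)
  qed
  \<comment> \<open>Index \<open>m\<close> gives \<open>Q\<close> and \<open>Suc m\<close> gives
    \<open>T\<close>, so the chain has \<open>Suc m\<close> steps.\<close>
  define V where "V = (\<lambda>i. if i \<le> m then upper_central Q i else T)"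
  interpret S: central_strongly_closed_series G p N T Q V "Suc m"
  proof (intro central_strongly_closed_series.intro finite_group_prime_axioms central_strongly_closed_series_axioms.intro)
    show "subgroup (V i) G" for i using upper_central_subgroup[OF Q(1)] Ts(1) by (simp add: V_def)
    show "conj_by G g x \<otimes> inv x \<in> V i" if "x \<in> V (Suc i)" "g \<in> Q" "i < Suc m" for i x g
    proof (cases "i = m")
      case True
      then show ?thesis using that QT m by (simp add: V_def)
    next
      case False
      then show ?thesis using that by (simp add: V_def)
    qed
    show "conj_by G h x \<in> V i" if "x \<in> V i" "h \<in> N" "conj_by G h x \<in> T" for i x h
      using that uc_closed by (auto simp: V_def split: if_splits)
  qed (use N T Q Q_closed in \<open>auto simp: V_def\<close>)
  show ?thesis
    using S.all_controlled[OF X] h unfolding S.controlled_def S.local_norm_def by blast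
qed

end

subsection \<open>Large subgroups\<close>

locale sylow_fusion = finite_group_prime G p for G (structure) and p +
  fixes S Q :: "'a set"
  assumes S: "sylow_subgroup p S G" and Q: "subgroup Q G" "Q \<subseteq> S"
begin

section \<open>The fusion system of S in G in terms of group elements\<close>

abbreviation F where "F \<equiv> fusion_of_group S G"

lemma S_subgroup: "subgroup S G" and sylow_S: "sylow_in S (carrier G)"
  using S by (simp_all add: sylow_subgroup_def)

lemma S_p_subgroup: "p_subgroup S"
  using sylow_in_p_subgroup[OF subgroup_self sylow_S] .

lemma fusion_inv: "x \<in> S \<Longrightarrow> inv\<^bsub>F\<^esub> x = inv x"
proof -
  assume "x \<in> S"
  then have "inv\<^bsub>G\<lparr>carrier := S\<rparr>\<^esub> x = inv x" using S_subgroup by (simp add: m_inv_consistent)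
  then show ?thesis by (simp add: m_inv_def fusion_of_group_def)
qed

lemma fusion_subgroup_iff: "subgroup U F \<longleftrightarrow> subgroup U G \<and> U \<subseteq> S"
proof -
  have "subgroup U F \<longleftrightarrow> subgroup U (G\<lparr>carrier := S\<rparr>)"
    by (simp add: subgroup_def m_inv_def fusion_of_group_def)
  also have "\<dots> \<longleftrightarrow> subgroup U G \<and> U \<subseteq> S"
    using incl_subgroup[OF S_subgroup] subgroup_incl[OF _ S_subgroup]
      subgroup.subset[of U "G\<lparr>carrier := S\<rparr>"] by auto
  finally show ?thesis .
qed

lemma fusion_centralizer: "centralizer F U = centralizer (G\<lparr>carrier := S\<rparr>) U"
  by (simp add: centralizer_def fusion_of_group_def)

lemma fusion_center: "center (F\<lparr>carrier := Q\<rparr>) = center (G\<lparr>carrier := Q\<rparr>)"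
  by (simp add: center_def centralizer_def fusion_of_group_def)

lemma fusion_normalizer_group:
  assumes "U \<subseteq> S"
  shows "normalizer F U = S \<inter> normalizer G U"
proof -
  have "U \<subseteq> carrier G" using assms S_subgroup subgroup.subset by blast
  moreover have "g <#\<^bsub>F\<^esub> U #>\<^bsub>F\<^esub> inv\<^bsub>F\<^esub> g = g <# U #> inv g" if "g \<in> S" for g
    using fusion_inv[OF that] by (simp add: l_coset_def r_coset_def fusion_of_group_def)
  ultimately show ?thesis
    using assms subgroup.subset[OF S_subgroup]
    \<comment> \<open>Only \<open>carrier F\<close> is unfolded here, so that the coset equation
      just proved still matches.\<close>
    by (auto simp: normalizer_def stabilizer_def fusion_of_group_def[of S G, THEN arg_cong[of _ _ carrier]])
qed

lemma fusion_set_mult: "A <#>\<^bsub>F\<^esub> B = A <#> B"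
  by (simp add: set_mult_def fusion_of_group_def)

lemma mem_fusion_Hom:
  "\<phi> \<in> Hom F X Y \<longleftrightarrow> subgroup X G \<and> X \<subseteq> S \<and> subgroup Y G \<and> Y \<subseteq> S \<and>
     (\<exists>g\<in>carrier G. conj_by G g ` X \<subseteq> Y \<and> \<phi> = restrict (conj_by G g) X)"
  by (simp add: fusion_of_group_def)

text \<open>An element inducing the extension to \<open>X <#> U\<close> normalizes \<open>U\<close>
  and agrees with the given morphism on \<open>X\<close>, so it can replace the element first
  chosen. Conversely conjugation by an element of \<open>normalizer G U\<close> extends to
  \<open>X <#> U\<close>.\<close>

lemma mem_fusion_normalizer_Hom:
  assumes U: "subgroup U G" "U \<subseteq> S"
  shows "\<phi> \<in> Hom (fusion_normalizer F U) X Y \<longleftrightarrow>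
    subgroup X G \<and> subgroup Y G \<and> X \<subseteq> S \<inter> normalizer G U \<and> Y \<subseteq> S \<inter> normalizer G U \<and>
    (\<exists>g\<in>normalizer G U. conj_by G g ` X \<subseteq> Y \<and> \<phi> = restrict (conj_by G g) X)"
    (is "_ \<longleftrightarrow> ?sub \<and> ?ex")
proof -
  have Uc: "U \<subseteq> carrier G" using U(1) by (rule subgroup.subset)
  have sub: "subgroup (X <#> U) G \<and> X <#> U \<subseteq> S \<and> X \<subseteq> X <#> U \<and> U \<subseteq> X <#> U"
    if "subgroup X G" "X \<subseteq> S \<inter> normalizer G U" for X
    using that set_mult_normalizer(1)[OF that(1) U(1)] set_mult_subset_subgroup[OF S_subgroup _ U(2), of X]
      subset_set_mult[OF that(1) U(1)] by blast
  show ?thesis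
  proof
    assume "\<phi> \<in> Hom (fusion_normalizer F U) X Y"
    then have phi: "\<phi> \<in> Hom F X Y" "X \<subseteq> S \<inter> normalizer G U" "Y \<subseteq> S \<inter> normalizer G U"
      and "\<exists>\<psi>\<in>Hom F (X <#> U) (Y <#> U). (\<forall>x\<in>X. \<psi> x = \<phi> x) \<and> \<psi> ` U = U"
      using U by (auto simp: fusion_normalizer_def fusion_normalizer_group fusion_set_mult)
    then obtain \<psi> where psi: "\<psi> \<in> Hom F (X <#> U) (Y <#> U)" "\<forall>x\<in>X. \<psi> x = \<phi> x" "\<psi> ` U = U" by blast
    obtain g where g: "g \<in> carrier G" "\<psi> = restrict (conj_by G g) (X <#> U)"
      using psi(1) by (auto simp: mem_fusion_Hom)
    obtain g' where g': "subgroup X G" "subgroup Y G" "conj_by G g' ` X \<subseteq> Y" "\<phi> = restrict (conj_by G g') X"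
      using phi(1) by (auto simp: mem_fusion_Hom)
    note X = sub[OF g'(1) phi(2)]
    have "\<psi> ` U = conj_by G g ` U" unfolding g(2) using X by (intro image_cong) auto
    then have "g \<in> normalizer G U" using psi(3) g(1) Uc by (simp add: mem_normalizer_iff)
    moreover have eq: "conj_by G g x = conj_by G g' x" if "x \<in> X" for x
      using psi(2) that X unfolding g(2) g'(4) by (auto split: if_splits)
    then have "conj_by G g ` X \<subseteq> Y" "\<phi> = restrict (conj_by G g) X"
      using g'(3,4) by (auto simp: restrict_def)
    ultimately show "?sub \<and> ?ex" using g' phi by blast
  next
    assume "?sub \<and> ?ex"
    then obtain g where s: "subgroup X G" "subgroup Y G" "X \<subseteq> S \<inter> normalizer G U" "Y \<subseteq> S \<inter> normalizer G U"
      and g: "g \<in> normalizer G U" "conj_by G g ` X \<subseteq> Y" "\<phi> = restrict (conj_by G g) X" by blast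
    have g': "g \<in> carrier G" "conj_by G g ` U = U" using g(1) Uc by (auto simp: mem_normalizer_iff)
    note X = sub[OF s(1,3)] and Y = sub[OF s(2,4)]
    have "conj_by G g ` (X <#> U) = conj_by G g ` X <#> U"
      using conj_by_set_mult[OF g'(1) subgroup.subset[OF s(1)] Uc] g'(2) by simp
    also have "\<dots> \<subseteq> Y <#> U" using g(2) by (intro mono_set_mult) auto
    finally have "restrict (conj_by G g) (X <#> U) \<in> Hom F (X <#> U) (Y <#> U)"
      using X Y g'(1) by (auto simp: mem_fusion_Hom)
    moreover have "\<forall>x\<in>X. restrict (conj_by G g) (X <#> U) x = \<phi> x" using X g(3) by auto
    moreover have "restrict (conj_by G g) (X <#> U) ` U = conj_by G g ` U"
      using X by (intro image_cong) auto
    then have "restrict (conj_by G g) (X <#> U) ` U = U" using g'(2) by simp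
    ultimately have "\<exists>\<psi>\<in>Hom F (X <#> U) (Y <#> U). (\<forall>x\<in>X. \<psi> x = \<phi> x) \<and> \<psi> ` U = U" by blast
    moreover have "\<phi> \<in> Hom F X Y" using s g g'(1) by (auto simp: mem_fusion_Hom)
    ultimately show "\<phi> \<in> Hom (fusion_normalizer F U) X Y"
      using s U by (simp add: fusion_normalizer_def fusion_normalizer_group fusion_set_mult)
  qed
qed

text \<open>The target \<open>Y\<close> disappears from the right-hand side: every morphism is onto
  its image followed by an inclusion, and the image may itself serve as target.\<close>

lemma fusion_subsystem_normalizer_iff:
  assumes U: "subgroup U G" "U \<subseteq> S"
  shows "fusion_subsystem (fusion_normalizer F U) (fusion_normalizer F Q) \<longleftrightarrow>
    S \<inter> normalizer G U \<subseteq> normalizer G Q \<and>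
    (\<forall>X h. subgroup X G \<longrightarrow> X \<subseteq> S \<inter> normalizer G U \<longrightarrow> h \<in> normalizer G U \<longrightarrow> conj_by G h ` X \<subseteq> S \<longrightarrow>
      (\<exists>k\<in>normalizer G Q. \<forall>x\<in>X. conj_by G k x = conj_by G h x))"
    (is "_ \<longleftrightarrow> ?sub \<and> ?ctrl")
proof
  have Uc: "U \<subseteq> carrier G" using U(1) by (rule subgroup.subset)
  have carr: "carrier (fusion_normalizer F U) = S \<inter> normalizer G U" 
    "carrier (fusion_normalizer F Q) = S \<inter> normalizer G Q"
    using U Q by (simp_all add: fusion_normalizer_def fusion_normalizer_group)
  {
    assume sys: "fusion_subsystem (fusion_normalizer F U) (fusion_normalizer F Q)"
    then have ?sub using carr by (auto simp: fusion_subsystem_def)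
    moreover have ?ctrl
    proof (intro allI impI)
      fix X h assume X: "subgroup X G" "X \<subseteq> S \<inter> normalizer G U"
        and h: "h \<in> normalizer G U" "conj_by G h ` X \<subseteq> S"
      have hc: "h \<in> carrier G" using h(1) Uc by (simp add: mem_normalizer_iff)
      have "conj_by G h ` X \<subseteq> normalizer G U"
        using conj_by_mem[OF normalizer_subgroup[OF Uc] h(1)] X(2) by blast
      then have "restrict (conj_by G h) X \<in> Hom (fusion_normalizer F U) X (conj_by G h ` X)"
        unfolding mem_fusion_normalizer_Hom[OF U] using X h conj_by_subgroup[OF hc X(1)] by blast
      then have "restrict (conj_by G h) X \<in> Hom (fusion_normalizer F Q) X (conj_by G h ` X)"
        using sys by (auto simp: fusion_subsystem_def)
      then obtain k where "k \<in> normalizer G Q" "restrict (conj_by G h) X = restrict (conj_by G k) X"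
        unfolding mem_fusion_normalizer_Hom[OF Q] by blast
      then show "\<exists>k\<in>normalizer G Q. \<forall>x\<in>X. conj_by G k x = conj_by G h x"
        by (metis restrict_apply')
    qed
    ultimately show "?sub \<and> ?ctrl" by blast
  next
    assume *: "?sub \<and> ?ctrl"
    have "\<phi> \<in> Hom (fusion_normalizer F Q) X Y" if "\<phi> \<in> Hom (fusion_normalizer F U) X Y" for \<phi> X Y
    proof -
      note hom = that[unfolded mem_fusion_normalizer_Hom[OF U]]
      then obtain h where h: "h \<in> normalizer G U" "conj_by G h ` X \<subseteq> Y" "\<phi> = restrict (conj_by G h) X"
        by blast
      have XY: "subgroup X G" "subgroup Y G" "X \<subseteq> S \<inter> normalizer G U" "Y \<subseteq> S \<inter> normalizer G U"
        using hom by simp_all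
      have "conj_by G h ` X \<subseteq> S" using h(2) XY(4) by blast
      then obtain k where k: "k \<in> normalizer G Q" "\<forall>x\<in>X. conj_by G k x = conj_by G h x"
        using *[THEN conjunct2, rule_format, of X h] h(1) XY by blast
      have "conj_by G k ` X = conj_by G h ` X" using k(2) by (intro image_cong) auto
      moreover have "restrict (conj_by G k) X = restrict (conj_by G h) X"
        using k(2) by (intro restrict_ext) auto
      ultimately have "\<phi> = restrict (conj_by G k) X" "conj_by G k ` X \<subseteq> Y"
        using h(2,3) by simp_all
      moreover have "X \<subseteq> S \<inter> normalizer G Q" "Y \<subseteq> S \<inter> normalizer G Q" using XY(3,4) conjunct1[OF *] by blast+
      ultimately show ?thesis
        unfolding mem_fusion_normalizer_Hom[OF Q] using XY k(1) by blast
    qed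
    then show "fusion_subsystem (fusion_normalizer F U) (fusion_normalizer F Q)"
      using * carr by (auto simp: fusion_subsystem_def)
  }
qed

section \<open>Central subgroups of Q and control of their normalizers\<close>

lemma mem_center_iff: "x \<in> center (G\<lparr>carrier := Q\<rparr>) \<longleftrightarrow> x \<in> Q \<and> (\<forall>q\<in>Q. x \<otimes> q = q \<otimes> x)"
  by (simp add: center_def centralizer_def)

lemma center_conj_by:
  assumes k: "k \<in> normalizer G Q" and U: "U \<subseteq> center (G\<lparr>carrier := Q\<rparr>)"
  shows "conj_by G k ` U \<subseteq> center (G\<lparr>carrier := Q\<rparr>)"
proof clarify
  fix x assume "x \<in> U"
  then have x: "x \<in> Q" "\<And>q. q \<in> Q \<Longrightarrow> x \<otimes> q = q \<otimes> x" using U mem_center_iff by auto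
  have Qc: "Q \<subseteq> carrier G" using Q(1) by (rule subgroup.subset)
  have k': "k \<in> carrier G" "conj_by G k ` Q = Q" using k Qc by (auto simp: mem_normalizer_iff)
  have "conj_by G k x \<otimes> q = q \<otimes> conj_by G k x" if "q \<in> Q" for q
  proof -
    obtain r where r: "r \<in> Q" "q = conj_by G k r" using \<open>q \<in> Q\<close> k'(2) by blast
    have "conj_by G k (x \<otimes> r) = conj_by G k (r \<otimes> x)" using x(2)[OF r(1)] by simp
    then show ?thesis using r k'(1) x(1) Qc by (simp add: conj_by_distrib subset_iff)
  qed
  then show "conj_by G k x \<in> center (G\<lparr>carrier := Q\<rparr>)"
    using k'(2) x(1) by (auto simp: mem_center_iff)
qed

lemma central_subset: "U \<subseteq> center (G\<lparr>carrier := Q\<rparr>) \<Longrightarrow> U \<subseteq> Q"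
  using mem_center_iff by auto

lemma Q_normalizes_central:
  assumes U: "U \<subseteq> center (G\<lparr>carrier := Q\<rparr>)"
  shows "Q \<subseteq> normalizer G U"
proof
  have Qc: "Q \<subseteq> carrier G" using Q(1) by (rule subgroup.subset)
  fix q assume q: "q \<in> Q"
  have "conj_by G q x = x" if "x \<in> U" for x
  proof -
    have "x \<in> Q" "x \<otimes> q = q \<otimes> x" using that U q mem_center_iff by auto
    then show ?thesis
      using q Qc by (simp add: conj_by_def m_assoc subset_iff) (simp add: subset_iff flip: m_assoc)
  qed
  then show "q \<in> normalizer G U"
    using central_subset[OF U] Qc q by (intro mem_normalizerI) auto
qed

text \<open>The inclusion of N_F(U) in N_F(Q), in the form given by
  \<open>fusion_subsystem_normalizer_iff\<close>.\<close>

definition controls :: "'a set \<Rightarrow> bool" where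
  "controls U \<longleftrightarrow> S \<inter> normalizer G U \<subseteq> normalizer G Q \<and>
    (\<forall>X h. subgroup X G \<longrightarrow> X \<subseteq> S \<inter> normalizer G U \<longrightarrow> h \<in> normalizer G U \<longrightarrow> conj_by G h ` X \<subseteq> S \<longrightarrow>
      (\<exists>k\<in>normalizer G Q. \<forall>x\<in>X. conj_by G k x = conj_by G h x))"

definition central_subgroup :: "'a set \<Rightarrow> bool" where
  "central_subgroup U \<longleftrightarrow> subgroup U G \<and> U \<noteq> {\<one>} \<and> U \<subseteq> center (G\<lparr>carrier := Q\<rparr>)"

lemma central_subgroupD:
  assumes "central_subgroup U"
  shows "subgroup U G" "U \<noteq> {\<one>}" "U \<subseteq> center (G\<lparr>carrier := Q\<rparr>)" "U \<subseteq> carrier G"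
proof -
  show U: "subgroup U G" and "U \<noteq> {\<one>}" "U \<subseteq> center (G\<lparr>carrier := Q\<rparr>)"
    using assms unfolding central_subgroup_def by blast+
  show "U \<subseteq> carrier G" using U by (rule subgroup.subset)
qed

lemma large_iff_controls:
  "large_in_fusion Q F \<longleftrightarrow>
    centralizer (G\<lparr>carrier := S\<rparr>) Q \<subseteq> Q \<and> (\<forall>U. central_subgroup U \<longrightarrow> controls U)"
proof -
  have one: "\<one>\<^bsub>F\<^esub> = \<one>" by (simp add: fusion_of_group_def)
  have "subgroup U F \<and> U \<noteq> {\<one>\<^bsub>F\<^esub>} \<and> U \<subseteq> center (F\<lparr>carrier := Q\<rparr>) \<longleftrightarrow> central_subgroup U" for U
    unfolding one central_subgroup_def fusion_subgroup_iff fusion_center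
    using central_subset[of U] Q(2) by (metis order_trans)
  moreover have "fusion_subsystem (fusion_normalizer F U) (fusion_normalizer F Q) \<longleftrightarrow> controls U"
    if "central_subgroup U" for U
    unfolding controls_def using that central_subset[of U] Q(2)
    by (intro fusion_subsystem_normalizer_iff) (auto simp: central_subgroup_def)
  moreover have "subgroup Q F" using Q by (simp add: fusion_subgroup_iff)
  ultimately show ?thesis
    unfolding large_in_fusion_def fusion_centralizer by (metis (no_types, lifting))
qed

text \<open>Apply control to Z(S), which is \<open>upper_central S 1\<close>. It is non-trivial as
  \<open>S\<close> is a non-trivial p-group, and it centralizes \<open>Q\<close>, so it lies in
  C_S(Q) \<le> Q and therefore in Z(Q). Since \<open>S\<close> normalizes Z(S), control puts
  \<open>S\<close> into \<open>normalizer G Q\<close>.\<close>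

lemma S_normalizes_Q:
  assumes cent: "centralizer (G\<lparr>carrier := S\<rparr>) Q \<subseteq> Q"
    and ctrl: "\<And>U. central_subgroup U \<Longrightarrow> controls U" and nontrivial: "S \<noteq> {\<one>}"
  shows "S \<subseteq> normalizer G Q"
proof -
  let ?Z = "upper_central S 1"
  have Z: "subgroup ?Z G" using S_subgroup by (rule upper_central_subgroup)
  have Sc: "S \<subseteq> carrier G" using S_subgroup by (rule subgroup.subset)
  have comm: "x \<otimes> g = g \<otimes> x" if "x \<in> ?Z" "g \<in> S" for x g
  proof -
    have xg: "x \<in> carrier G" "g \<in> carrier G" using that Sc by auto
    have "conj_by G g x \<otimes> inv x = \<one>" using that by simp
    then have "conj_by G g x = x" using xg by (metis conj_by_closed inv_closed inv_equality inv_inv)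
    then have "g \<otimes> x = g \<otimes> (inv g \<otimes> (x \<otimes> g))" using xg by (simp add: conj_by_def m_assoc)
    also have "\<dots> = x \<otimes> g" using xg by (simp flip: m_assoc)
    finally show ?thesis by simp
  qed
  have "{\<one>} \<subset> S" using nontrivial subgroup.one_closed[OF S_subgroup] by blast
  moreover have "S \<subseteq> normalizer G {\<one>}"
    using Sc by (auto simp: mem_normalizer_iff conj_by_def)
  ultimately obtain x where x: "x \<in> S" "x \<notin> {\<one>}" "\<And>g. g \<in> S \<Longrightarrow> conj_by G g x \<otimes> inv x \<in> {\<one>}"
    using p_subgroup_central_mod[OF S_p_subgroup triv_subgroup] by blast
  then have "x \<in> ?Z" by simp
  then have "?Z \<noteq> {\<one>}" using x(2) by blast
  moreover have "?Z \<subseteq> center (G\<lparr>carrier := Q\<rparr>)"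
  proof
    fix z assume z: "z \<in> ?Z"
    then have "z \<in> S" using upper_central_subset[OF S_subgroup] by blast
    then have "z \<in> centralizer (G\<lparr>carrier := S\<rparr>) Q"
      using comm[OF z] Q(2) unfolding centralizer_def by auto
    then show "z \<in> center (G\<lparr>carrier := Q\<rparr>)"
      using cent comm[OF z] Q(2) unfolding mem_center_iff by blast
  qed
  ultimately have "controls ?Z" using Z ctrl by (simp add: central_subgroup_def del: upper_central.simps)
  moreover have "S \<subseteq> normalizer G ?Z"
    using upper_central_normalizer[OF S_subgroup] subgroup_le_normalizer[OF S_subgroup] by blast
  ultimately show ?thesis unfolding controls_def by blast
qed

text \<open>A conjugate \<open>U\<close> with \<open>S \<inter> normalizer G U\<close> as large as possible works: the control condition
  puts the normalizer of this intersection inside a Sylow subgroup of \<open>normalizer G U\<close> into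
  \<open>normalizer G Q\<close>, hence back into \<open>S\<close> after conjugation.\<close>

lemma conjugate_fully_normalized:
  assumes SQ: "S \<subseteq> normalizer G Q" and ctrl: "\<And>U. central_subgroup U \<Longrightarrow> controls U"
    and U: "central_subgroup U"
  obtains n where "n \<in> normalizer G Q" "central_subgroup (conj_by G n ` U)"
    "sylow_in (S \<inter> normalizer G (conj_by G n ` U)) (normalizer G (conj_by G n ` U))"
proof -
  have Qc: "Q \<subseteq> carrier G" using Q(1) by (rule subgroup.subset)
  have NQ: "subgroup (normalizer G Q) G" using Qc by (rule normalizer_subgroup)
  have sylow_SQ: "sylow_in S (normalizer G Q)"
  proof -
    obtain T where T: "sylow_in T (normalizer G Q)" "S \<subseteq> T"
      using sylow_containing[OF NQ S_p_subgroup SQ] .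
    have "T \<subseteq> carrier G" using T(1) NQ by (auto simp: sylow_in_iff subgroup.subset)
    then have "T = S"
      using sylow_in_maximal[OF subgroup_self sylow_S sylow_in_p_subgroup[OF NQ T(1)]] T(2) by blast
    then show ?thesis using T(1) by simp
  qed
  note U' = central_subgroupD[OF U]
  have c: "n \<in> carrier G" if "n \<in> normalizer G Q" for n using that Qc by (simp add: mem_normalizer_iff)
  have conj_U: "central_subgroup (conj_by G n ` U)" if n: "n \<in> normalizer G Q" for n
  proof -
    have "conj_by G n ` U \<noteq> {\<one>}"
    proof
      assume "conj_by G n ` U = {\<one>}"
      then have "conj_by G (inv n) ` {\<one>} = U" using conj_by_image_cancel(1)[OF c[OF n] U'(4)] by simp
      then show False using U'(2) c[OF n] by (simp add: conj_by_def)
    qed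
    then show ?thesis
      using conj_by_subgroup[OF c[OF n] U'(1)] center_conj_by[OF n U'(3)] by (simp add: central_subgroup_def)
  qed
  define f where "f n = card (S \<inter> normalizer G (conj_by G n ` U))" for n
  have fin: "finite (f ` normalizer G Q)" using finite_subgroup[OF NQ] by simp
  have "f ` normalizer G Q \<noteq> {}" using subgroup.one_closed[OF NQ] by blast
  then obtain n where n: "n \<in> normalizer G Q" "f n = Max (f ` normalizer G Q)"
    using Max_in[OF fin] by (metis imageE)
  have max: "f k \<le> f n" if "k \<in> normalizer G Q" for k
    unfolding n(2) using fin that by (intro Max_ge) auto
  define W where "W = conj_by G n ` U"
  have W: "central_subgroup W" unfolding W_def using n(1) by (rule conj_U)
  note W' = central_subgroupD(3,4)[OF W]
  have NW: "subgroup (normalizer G W) G" using W'(2) by (rule normalizer_subgroup)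
  define R where "R = S \<inter> normalizer G W"
  have R: "subgroup R G" unfolding R_def using S_subgroup NW by (rule subgroups_Inter_pair)
  have QR: "Q \<subseteq> R" using Q(2) Q_normalizes_central[OF W'(1)] by (simp add: R_def)
  have "p_subgroup R" using p_subgroup_mono[OF S_p_subgroup R] by (simp add: R_def)
  then obtain T where T: "sylow_in T (normalizer G W)" "R \<subseteq> T"
    using sylow_containing[OF NW] by (metis R_def inf_le2)
  have T': "p_subgroup T" "T \<subseteq> normalizer G W"
    using sylow_in_p_subgroup[OF NW T(1)] T(1) NW by (auto simp: sylow_in_iff)
  have "T = R"
  proof (rule ccontr)
    assume "T \<noteq> R"
    then obtain t where t: "t \<in> T" "t \<notin> R" "t \<in> normalizer G R"
      using p_subgroup_normalizer_grows[OF T'(1) R] T(2) by blast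
    define M where "M = T \<inter> normalizer G R"
    have Rc: "R \<subseteq> carrier G" using R by (rule subgroup.subset)
    have M: "subgroup M G"
      unfolding M_def using p_subgroupD[OF T'(1)] normalizer_subgroup[OF Rc] by (rule subgroups_Inter_pair)
    have Mp: "p_subgroup M" using p_subgroup_mono[OF T'(1) M] by (simp add: M_def)
    have RM: "R \<subset> M" using T(2) subgroup_le_normalizer[OF R] t by (auto simp: M_def)
    \<comment> \<open>An element \<open>s\<close> of \<open>M\<close> induces an automorphism of
      \<open>R\<close>, which control realizes inside \<open>normalizer G Q\<close>. As
      \<open>Q \<le> R\<close>, \<open>s\<close> acts on \<open>Q\<close> like that element and so
      normalizes \<open>Q\<close>.\<close>
    have "M \<subseteq> normalizer G Q"
    proof
      fix s assume "s \<in> M"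
      then have s: "s \<in> normalizer G W" "s \<in> carrier G" "conj_by G s ` R = R"
        using T'(2) Rc by (auto simp: M_def mem_normalizer_iff)
      have "conj_by G s ` R \<subseteq> S" using s(3) by (simp add: R_def)
      then obtain k where k: "k \<in> normalizer G Q" "\<forall>x\<in>R. conj_by G k x = conj_by G s x"
        using ctrl[OF W] R s(1) unfolding controls_def R_def by (meson order_refl)
      have "conj_by G s ` Q = conj_by G k ` Q" using k(2) QR by (intro image_cong) auto
      then show "s \<in> normalizer G Q" using k(1) s(2) Qc by (simp add: mem_normalizer_iff)
    qed
    \<comment> \<open>\<open>S\<close> is Sylow in \<open>normalizer G Q\<close>, so
      \<open>M\<close> moves into \<open>S\<close>. There it normalizes the conjugate of
      \<open>U\<close> by \<open>n \<otimes> k\<close>, against the maximal choice of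
      \<open>n\<close>.\<close>
    then obtain k where k: "k \<in> normalizer G Q" "conj_by G k ` M \<subseteq> S"
      using p_subgroup_conj_into_sylow[OF NQ sylow_SQ Mp] by blast
    have "conj_by G k ` M \<subseteq> normalizer G (conj_by G k ` W)"
      using normalizer_conj_by[OF W'(2) c[OF k(1)]] T'(2) by (auto simp: M_def)
    also have "conj_by G k ` W = conj_by G (n \<otimes> k) ` U"
      using c[OF n(1)] c[OF k(1)] U'(4) by (simp add: W_def conj_by_image_mult)
    finally have "conj_by G k ` M \<subseteq> S \<inter> normalizer G (conj_by G (n \<otimes> k) ` U)" using k(2) by blast
    then have "card (conj_by G k ` M) \<le> f (n \<otimes> k)"
      unfolding f_def using finite_subgroup[OF S_subgroup] by (intro card_mono) auto
    also have "\<dots> \<le> f n" using max n(1) k(1) NQ by (simp add: subgroup.m_closed)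
    also have "\<dots> = card R" by (simp add: f_def R_def W_def)
    also have "\<dots> < card M" using RM finite_subgroup[OF M] by (rule psubset_card_mono[rotated])
    also have "\<dots> = card (conj_by G k ` M)"
      using card_conj_by_image[OF c[OF k(1)] subgroup.subset[OF M]] by simp
    finally show False by simp
  qed
  then show thesis using that[OF n(1)] W T(1) by (simp add: W_def R_def)
qed

text \<open>Replace \<open>U\<close> by a conjugate \<open>W\<close> under
  \<open>normalizer G Q\<close> whose normalizer has a Sylow subgroup inside \<open>S\<close>.
  Fusion of \<open>normalizer G W\<close> in \<open>S\<close> is induced by
  \<open>normalizer G Q\<close>, which preserves \<open>C\<close>; conjugating by
  \<open>inv n\<close> returns to \<open>U\<close>.\<close>

lemma controls_imp_strongly_closed:
  assumes cent: "centralizer (G\<lparr>carrier := S\<rparr>) Q \<subseteq> Q"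
    and ctrl: "\<And>U. central_subgroup U \<Longrightarrow> controls U"
    and U: "central_subgroup U" and C: "characteristic_subgroup C (G\<lparr>carrier := Q\<rparr>)"
  shows "strongly_closed p C (G\<lparr>carrier := normalizer G U\<rparr>)"
proof -
  have Qc: "Q \<subseteq> carrier G" using Q(1) by (rule subgroup.subset)
  have NQ: "subgroup (normalizer G Q) G" using Qc by (rule normalizer_subgroup)
  have CQ: "subgroup C G" "C \<subseteq> Q"
    using C incl_subgroup[OF Q(1)] subgroup.subset[of C "G\<lparr>carrier := Q\<rparr>"]
    by (simp_all add: characteristic_subgroup_def)
  note U' = central_subgroupD[OF U]
  have NU: "subgroup (normalizer G U) G" using U'(4) by (rule normalizer_subgroup)
  have "S \<noteq> {\<one>}"
    using U'(1,2) central_subset[OF U'(3)] Q(2) subgroup.one_closed[OF U'(1)] by auto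
  then have SQ: "S \<subseteq> normalizer G Q" using S_normalizes_Q[OF cent ctrl] by blast
  obtain n where n: "n \<in> normalizer G Q" "central_subgroup (conj_by G n ` U)"
    "sylow_in (S \<inter> normalizer G (conj_by G n ` U)) (normalizer G (conj_by G n ` U))"
    using conjugate_fully_normalized[OF SQ ctrl U] .
  have nc: "n \<in> carrier G" and inQ: "inv n \<in> normalizer G Q"
    using n(1) NQ by (auto simp: subgroup.mem_carrier subgroup.m_inv_closed)
  define W where "W = conj_by G n ` U"
  define T where "T = conj_by G (inv n) ` (S \<inter> normalizer G W)"
  note W = central_subgroupD(3,4)[OF n(2), folded W_def]
  have NW: "normalizer G W = conj_by G n ` normalizer G U"
    unfolding W_def using U'(4) nc by (rule normalizer_conj_by)
  have NWs: "subgroup (normalizer G W) G" using W(2) by (rule normalizer_subgroup)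
  have "conj_by G (inv n) ` normalizer G W = normalizer G U"
    unfolding NW using nc subgroup.subset[OF NU] by simp
  then have T: "sylow_in T (normalizer G U)"
    using sylow_in_conj_by[OF NWs n(3)[folded W_def], of "inv n"] nc by (simp add: T_def)
  have QR: "Q \<subseteq> S \<inter> normalizer G W" using Q(2) Q_normalizes_central[OF W(1)] by blast
  have "conj_by G (inv n) ` Q \<subseteq> T" unfolding T_def using QR by (rule image_mono)
  moreover have "conj_by G (inv n) ` Q = Q" using inQ Qc by (simp add: mem_normalizer_iff)
  ultimately have CT: "C \<subseteq> T" using CQ(2) by simp
  have char: "conj_by G k x \<in> C" if "k \<in> normalizer G Q" "x \<in> C" for k x
    using characteristic_conj_by[OF Q(1) that(1) C] that(2) by blast
  have "conj_by G h x \<in> C" if x: "x \<in> C" and h: "h \<in> normalizer G U" and hx: "conj_by G h x \<in> T" for x h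
  proof -
    have hc: "h \<in> carrier G" using h NU by (simp add: subgroup.mem_carrier)
    have xc: "x \<in> carrier G" using x CQ Qc by blast
    define y where "y = conj_by G n x"
    define g where "g = conj_by G n h"
    have yC: "y \<in> C" unfolding y_def using n(1) x by (rule char)
    have yc: "y \<in> carrier G" and gc: "g \<in> carrier G" using nc xc hc by (auto simp: y_def g_def)
    have gW: "g \<in> normalizer G W" using h by (simp add: NW g_def)
    have gy: "conj_by G g y = conj_by G n (conj_by G h x)"
      using nc hc xc by (simp add: g_def y_def conj_by_conj_by)
    obtain r where r: "r \<in> S" "conj_by G h x = conj_by G (inv n) r" using hx by (auto simp: T_def)
    then have gyS: "conj_by G g y \<in> S"
      unfolding gy using nc subgroup.mem_carrier[OF S_subgroup] by simp
    \<comment> \<open>Control speaks about subgroups, not elements. \<open>X\<close> is the largest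
      subgroup of \<open>Q\<close> that \<open>g\<close> maps into \<open>S\<close>, and it contains
      \<open>y\<close>.\<close>
    define X where "X = Q \<inter> conj_by G (inv g) ` S"
    have Sc: "S \<subseteq> carrier G" using S_subgroup by (rule subgroup.subset)
    have X: "subgroup X G"
      unfolding X_def using Q(1) conj_by_subgroup[OF inv_closed[OF gc] S_subgroup] by (rule subgroups_Inter_pair)
    have XS: "X \<subseteq> S \<inter> normalizer G W" using QR by (auto simp: X_def)
    have "conj_by G g ` X \<subseteq> S" using gc Sc by (auto simp: X_def)
    then obtain k where k: "k \<in> normalizer G Q" "\<forall>x\<in>X. conj_by G k x = conj_by G g x"
      using ctrl[OF n(2)] X XS gW unfolding controls_def W_def by meson
    have "y = conj_by G (inv g) (conj_by G g y)" using gc yc by simp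
    then have "y \<in> X" using gyS yC CQ(2) by (auto simp: X_def)
    then have "conj_by G g y \<in> C" using k char[OF k(1) yC] by simp
    then have "conj_by G (inv n) (conj_by G g y) \<in> C" using inQ by (rule char[rotated])
    then show ?thesis using nc hc xc by (simp add: gy)
  qed
  moreover have "subgroup C (G\<lparr>carrier := normalizer G U\<rparr>)"
    using CQ Q_normalizes_central[OF U'(3)] by (intro subgroup_incl[OF _ NU]) auto
  ultimately show ?thesis
    unfolding strongly_closed_def using T CT conj_by_consistent[OF NU] by auto
qed

text \<open>Choose a Sylow subgroup \<open>T\<close> of \<open>normalizer G U\<close> containing
  \<open>S \<inter> normalizer G U\<close>. As \<open>Q\<close> is characteristic in itself, it is
  strongly closed and hence normalized by \<open>T\<close>; this gives the first half of
  \<open>controls\<close>. The second half is the control theorem applied inside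
  \<open>normalizer G U\<close>.\<close>

lemma strongly_closed_imp_controls:
  assumes U: "central_subgroup U"
    and closed: "\<And>C. characteristic_subgroup C (G\<lparr>carrier := Q\<rparr>) \<Longrightarrow>
      strongly_closed p C (G\<lparr>carrier := normalizer G U\<rparr>)"
  shows "controls U"
proof -
  have Qc: "Q \<subseteq> carrier G" using Q(1) by (rule subgroup.subset)
  note U' = central_subgroupD(3,4)[OF U]
  have NU: "subgroup (normalizer G U) G" using U'(2) by (rule normalizer_subgroup)
  have SN: "p_subgroup (S \<inter> normalizer G U)"
    using p_subgroup_mono[OF S_p_subgroup subgroups_Inter_pair[OF S_subgroup NU]] by simp
  obtain T where T: "sylow_in T (normalizer G U)" "S \<inter> normalizer G U \<subseteq> T"
    using sylow_containing[OF NU SN] by blast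
  have Ts: "subgroup T G" "T \<subseteq> normalizer G U" using T(1) NU by (auto simp: sylow_in_iff)
  have QT: "Q \<subseteq> T" using T(2) Q(2) Q_normalizes_central[OF U'(1)] by blast
  have "characteristic_subgroup Q (G\<lparr>carrier := Q\<rparr>)"
    using Q(1) by (auto simp: characteristic_subgroup_def auto_def Bij_def bij_betw_def subgroup_incl)
  then have Q_closed: "strongly_closed p Q (G\<lparr>carrier := normalizer G U\<rparr>)" by (rule closed)
  have "t \<in> normalizer G Q" if "t \<in> S \<inter> normalizer G U" for t
  proof -
    have t: "t \<in> T" "t \<in> normalizer G U" using that T(2) by auto
    have "conj_by G t ` Q \<subseteq> Q"
      using strongly_closed_any_sylow[OF NU Q_closed T(1) QT] t(2) conj_by_mem[OF Ts(1) t(1)] QT by blast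
    then show ?thesis using t(1) Ts(1) Qc by (intro mem_normalizerI) (auto simp: subgroup.mem_carrier)
  qed
  moreover have "\<exists>k\<in>normalizer G Q. \<forall>x\<in>X. conj_by G k x = conj_by G h x"
    if X: "subgroup X G" "X \<subseteq> S \<inter> normalizer G U" and h: "h \<in> normalizer G U" "conj_by G h ` X \<subseteq> S" for X h
  proof -
    have "conj_by G h ` X \<subseteq> T"
      using T(2) h(2) conj_by_mem[OF NU h(1)] X(2) by blast
    moreover have "X \<subseteq> T" using X(2) T(2) by (rule order_trans)
    ultimately show ?thesis
      using control_of_characteristic_strongly_closed[OF NU T(1) Q(1) QT closed X(1) _ h(1)] by auto
  qed
  ultimately show ?thesis unfolding controls_def by blast
qed

end

theorem lemma1p4:
  fixes p :: nat and G (structure) and S Q :: "'a set"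
  assumes "prime p"
    and "group G" and "finite (carrier G)"
    and "sylow_subgroup p S G"
    and "subgroup Q G" and "Q \<subseteq> S"
  shows "large_in_fusion Q (fusion_of_group S G) \<longleftrightarrow>
    centralizer (G\<lparr>carrier := S\<rparr>) Q \<subseteq> Q \<and>
    (\<forall>P. subgroup P G \<and> P \<noteq> {\<one>} \<and> P \<subseteq> center (G\<lparr>carrier := Q\<rparr>) \<longrightarrow>
      (\<forall>C. characteristic_subgroup C (G\<lparr>carrier := Q\<rparr>) \<longrightarrow>
        strongly_closed p C (G\<lparr>carrier := normalizer G P\<rparr>)))"
proof -
  interpret sylow_fusion G p S Q
    using assms
    by (intro sylow_fusion.intro finite_group_prime.intro finite_group_prime_axioms.intro
        sylow_fusion_axioms.intro)
  show ?thesis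
    unfolding large_iff_controls
  \<comment> \<open>\<open>conj_cong\<close> keeps the common condition C_S(Q) \<le> Q available
    while the second conjuncts are compared; the forward direction uses it.\<close>
  proof (intro conj_cong refl iffI allI impI)
    fix P C
    assume "centralizer (G\<lparr>carrier := S\<rparr>) Q \<subseteq> Q" "\<forall>U. central_subgroup U \<longrightarrow> controls U"
      "subgroup P G \<and> P \<noteq> {\<one>} \<and> P \<subseteq> center (G\<lparr>carrier := Q\<rparr>)"
      "characteristic_subgroup C (G\<lparr>carrier := Q\<rparr>)"
    then show "strongly_closed p C (G\<lparr>carrier := normalizer G P\<rparr>)"
      by (intro controls_imp_strongly_closed) (simp_all add: central_subgroup_def)
  next
    fix U
    assume *: "\<forall>P. subgroup P G \<and> P \<noteq> {\<one>} \<and> P \<subseteq> center (G\<lparr>carrier := Q\<rparr>) \<longrightarrow>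
      (\<forall>C. characteristic_subgroup C (G\<lparr>carrier := Q\<rparr>) \<longrightarrow>
        strongly_closed p C (G\<lparr>carrier := normalizer G P\<rparr>))"
      and U: "central_subgroup U"
    show "controls U"
      using strongly_closed_imp_controls[OF U] * U unfolding central_subgroup_def by simp
  qed
qed

end
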